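(* A choice function $\operatorname{opt}$ satisfies the conditioning property, the intersection property and the mixture property if and only if there is a consistent and strongly consequentialist extensive form operator $\operatorname{ext}$ such that $\operatorname{opt}_{\operatorname{ext}}=\operatorname{opt}$, i.e. $\operatorname{opt}_{\operatorname{ext}}(\mathcal{X}|A)=\operatorname{opt}(\mathcal{X}|A)$ for every non-empty event $A$ and every non-empty finite $A$-consistent set of gambles $\mathcal{X}$.
   Context: **Gambles.** $\Omega$ is a finite set (the possibility space); subsets of $\Omega$ are events; $\overline{A}=\Omega\setminus A$. $\mathcal{R}$ is an arbitrary set of rewards. A gamble is a function $X\colon\Omega\to\mathcal{R}$. For an event $E$ and a gamble $X$, $EX$ is the restriction of $X$ to $E$, and $\oplus$ combines partial maps with disjoint domains: if $E_1,\dots,E_n$ is a partition of $\Omega$, $\bigoplus_{i=1}^n E_iX_i$ is the gamble that equals $X_i$ on each $E_i$. For sets of gambles, $\bigoplus_{i=1}^n E_i\mathcal{X}_i=\{\bigoplus_{i=1}^n E_iX_i\colon X_i\in\mathcal{X}_i\}$; for an event $A$ and a gamble $Z$, $A\mathcal{X}\oplus\overline{A}Z=\{AX\oplus\overline{A}Z\colon X\in\mathcal{X}\}$. **Choice functions.** A choice function $\operatorname{opt}$ maps every non-empty finite set $\mathcal{X}$ of gambles and every non-empty event $A$ to a set $\operatorname{opt}(\mathcal{X}|A)$ with $\emptyset\neq\operatorname{opt}(\mathcal{X}|A)\subseteq\mathcal{X}$. **Decision trees.** A decision tree is a finite rooted tree whose leaves carry rewards in $\mathcal{R}$ and whose other nodes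 are decision nodes or chance nodes; the arcs out of a chance node are labelled by events forming a finite partition of $\Omega$. Each tree $T$ carries an event $\operatorname{ev}(T)$ (the intersection of all events on chance arcs that have preceded $T$). $T=\bigsqcup_{i=1}^n T_i$ means the root of $T$ is a decision node with subtrees $T_i$ at its children; then $\operatorname{ev}(T_i)=\operatorname{ev}(T)$. $T=\bigodot_{i=1}^n E_iT_i$ means the root is a chance node with $T_i$ attached by the arc labelled $E_i$; then $\operatorname{ev}(T_i)=\operatorname{ev}(T)\cap E_i$. For a node $N$ of $T$, $\operatorname{st}_N(T)$ is the subtree of $T$ at $N$ (remove all non-descendants of $N$), with $\operatorname{ev}(\operatorname{st}_N(T))$ the intersection of $\operatorname{ev}(T)$ with all events on chance arcs on the path from the root of $T$ to $N$. A tree $T$ is called consistent if $\operatorname{ev}(\operatorname{st}_N(T))\neq\emptyset$ for every node $N$ of $T$; only consistent trees are considered. **Extensive and normal form.** An extensive form solution of $T$ is a subtree of $T$ with the same root (and the same $\operatorname{ev}$) in which at each decision node that remains a non-empty subset of its arcs is kept and at each chance node that remains all arcs are kept; its nodes are regarded as nodes of $T$. A normal form decision of $T$ is an extensive form solution with exactly one arc out of each decision node; $\operatorname{nfd}(T)$ is the set of all of them. An extensive form operator maps each decision tree to an extensive form solution of it. $\operatorname{gamb}(T)$ is defined recursively: $\{r\}$ (constant gamble) if $T$ is a leaf with reward $r$; $\operatorname{gamb}(\bigodot_{i} E_iT_i)=\bigoplus_{i} E_i\operatorname{gamb}(T_i)$; $\operatorname{gamb}(\bigsqcup_i T_i)=\bigcup_i\operatorname{gamb}(T_i)$.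 **Properties of extensive form operators.** An extensive form operator $\operatorname{ext}$ is: - consistent (= subtree perfect) if for every consistent decision tree $T$ and every node $N$ in $\operatorname{ext}(T)$, $\operatorname{st}_N(\operatorname{ext}(T))=\operatorname{ext}(\operatorname{st}_N(T))$; - consequentialist if for any (consistent) decision trees $T_1,T_2$ with $\operatorname{gamb}(T_1)=\operatorname{gamb}(T_2)$ and $\operatorname{ev}(T_1)=\operatorname{ev}(T_2)$, $\operatorname{gamb}(\operatorname{ext}(T_1))=\operatorname{gamb}(\operatorname{ext}(T_2))$; - strongly consequentialist if it is consequentialist and, for every (consistent) decision tree $T$ and every $U\in\operatorname{nfd}(T)$ with $\operatorname{gamb}(U)\subseteq\operatorname{gamb}(\operatorname{ext}(T))$, one has $U\in\operatorname{nfd}(\operatorname{ext}(T))$. **$A$-consistency.** For a non-empty event $A$, a non-empty finite set $\mathcal{X}$ of gambles is $A$-consistent if for all $r\in\mathcal{R}$ and $X\in\mathcal{X}$ with $X^{-1}(r)\neq\emptyset$ one has $X^{-1}(r)\cap A\neq\emptyset$ (equivalently, there is a consistent decision tree $T$ with $\operatorname{ev}(T)=A$ and $\operatorname{gamb}(T)=\mathcal{X}$). A gamble $X$ is $A$-consistent if $\{X\}$ is. **Induced choice function.** For a consistent and consequentialist $\operatorname{ext}$, $\operatorname{opt}_{\operatorname{ext}}(\mathcal{X}|A)=\operatorname{gamb}(\operatorname{ext}(T))$, where $T$ is any consistent decision tree with $\operatorname{gamb}(T)=\mathcal{X}$ and $\operatorname{ev}(T)=A$ (this does not depend on the choice of $T$;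 such $T$ exists exactly when $\mathcal{X}$ is $A$-consistent). **Properties of $\operatorname{opt}$.** - Conditioning property: for every non-empty event $A$, every non-empty finite $A$-consistent set of gambles $\mathcal{X}$ and all $X,Y\in\mathcal{X}$ with $AX=AY$: if $X\in\operatorname{opt}(\mathcal{X}|A)$ then $Y\in\operatorname{opt}(\mathcal{X}|A)$. - Intersection property: for every event $A\neq\emptyset$ and non-empty finite $A$-consistent sets of gambles $\mathcal{Y}\subseteq\mathcal{X}$ with $\operatorname{opt}(\mathcal{X}|A)\cap\mathcal{Y}\neq\emptyset$: $\operatorname{opt}(\mathcal{Y}|A)=\operatorname{opt}(\mathcal{X}|A)\cap\mathcal{Y}$. - Mixture property: for all events $A,B$ with $A\cap B\neq\emptyset$ and $\overline{A}\cap B\neq\emptyset$, every $\overline{A}\cap B$-consistent gamble $Z$ and every non-empty finite $A\cap B$-consistent set of gambles $\mathcal{X}$: $\operatorname{opt}(A\mathcal{X}\oplus\overline{A}Z|B)=A\operatorname{opt}(\mathcal{X}|A\cap B)\oplus\overline{A}Z$. *)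

theory Defs
  imports Main "HOL-Library.Finite_Map" "HOL-Library.FuncSet" "HOL-Library.Disjoint_Sets"
begin

text \<open>The possibility space is a finite type \<open>'w\<close>, the set of rewards an arbitrary type \<open>'r\<close>.\<close>

type_synonym ('w, 'r) gamble = "'w \<Rightarrow> 'r"

text \<open>For a map \<open>M\<close> from the cells \<open>E\<^sub>i\<close> of a partition to sets of gambles \<open>\<X>\<^sub>i\<close>, this is
  \<open>\<Oplus>\<^sub>i E\<^sub>i \<X>\<^sub>i\<close>; the function \<open>h\<close> chooses one gamble from each \<open>\<X>\<^sub>i\<close>.\<close>

definition oplus_sets :: "('w set, ('w, 'r) gamble set) fmap \<Rightarrow> ('w, 'r) gamble set" where
  "oplus_sets M = {X. \<exists>h. \<forall>E \<XX>. fmlookup M E = Some \<XX> \<longrightarrow>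
     h E \<in> \<XX> \<and> restrict X E = restrict (h E) E}"

definition mix :: "'w set \<Rightarrow> ('w, 'r) gamble \<Rightarrow> ('w, 'r) gamble \<Rightarrow> ('w, 'r) gamble" where
  "mix A X Z = (\<lambda>w. if w \<in> A then X w else Z w)"

definition event_consistent :: "'w set \<Rightarrow> ('w, 'r) gamble set \<Rightarrow> bool" where
  "event_consistent A \<XX> \<longleftrightarrow>
     (\<forall>r. \<forall>X\<in>\<XX>. X -` {r} \<noteq> {} \<longrightarrow> X -` {r} \<inter> A \<noteq> {})"

type_synonym ('w, 'r) choice = "('w, 'r) gamble set \<Rightarrow> 'w set \<Rightarrow> ('w, 'r) gamble set"

definition choice_function :: "('w, 'r) choice \<Rightarrow> bool" where
  "choice_function opt \<longleftrightarrow>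
     (\<forall>\<XX> A. finite \<XX> \<longrightarrow> \<XX> \<noteq> {} \<longrightarrow> A \<noteq> {} \<longrightarrow> opt \<XX> A \<noteq> {} \<and> opt \<XX> A \<subseteq> \<XX>)"

definition conditioning_property :: "('w, 'r) choice \<Rightarrow> bool" where
  "conditioning_property opt \<longleftrightarrow>
     (\<forall>A \<XX>. A \<noteq> {} \<longrightarrow> \<XX> \<noteq> {} \<longrightarrow> finite \<XX> \<longrightarrow> event_consistent A \<XX> \<longrightarrow>
        (\<forall>X\<in>\<XX>. \<forall>Y\<in>\<XX>. restrict X A = restrict Y A \<longrightarrow> X \<in> opt \<XX> A \<longrightarrow> Y \<in> opt \<XX> A))"

definition intersection_property :: "('w, 'r) choice \<Rightarrow> bool" where
  "intersection_property opt \<longleftrightarrow>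
     (\<forall>A \<XX> \<YY>. A \<noteq> {} \<longrightarrow>
        \<XX> \<noteq> {} \<longrightarrow> finite \<XX> \<longrightarrow> event_consistent A \<XX> \<longrightarrow>
        \<YY> \<noteq> {} \<longrightarrow> finite \<YY> \<longrightarrow> event_consistent A \<YY> \<longrightarrow>
        \<YY> \<subseteq> \<XX> \<longrightarrow> opt \<XX> A \<inter> \<YY> \<noteq> {} \<longrightarrow> opt \<YY> A = opt \<XX> A \<inter> \<YY>)"

definition mixture_property :: "('w, 'r) choice \<Rightarrow> bool" where
  "mixture_property opt \<longleftrightarrow>
     (\<forall>A B Z \<XX>. A \<inter> B \<noteq> {} \<longrightarrow> - A \<inter> B \<noteq> {} \<longrightarrow> event_consistent (- A \<inter> B) {Z} \<longrightarrow>
        \<XX> \<noteq> {} \<longrightarrow> finite \<XX> \<longrightarrow> event_consistent (A \<inter> B) \<XX> \<longrightarrow>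
        opt ((\<lambda>X. mix A X Z) ` \<XX>) B = (\<lambda>X. mix A X Z) ` opt \<XX> (A \<inter> B))"

text \<open>The arcs out of a decision node carry names, chosen freely from the natural numbers, and
  a subtree of a tree keeps the names of its arcs. So a node is identified by the path of arcs
  leading to it, two choices with isomorphic continuations remain distinct, and the nodes of an
  extensive form solution of a tree are nodes of that tree. The arcs out of a chance node are
  named by their events.\<close>

datatype ('w, 'r) tree =
    Leaf 'r
  | Decision "(nat, ('w, 'r) tree) fmap"
  | Chance "('w set, ('w, 'r) tree) fmap"

text \<open>A decision tree comes with the event that has preceded it.\<close>

type_synonym ('w, 'r) dtree = "'w set \<times> ('w, 'r) tree"

abbreviation ev :: "('w, 'r) dtree \<Rightarrow> 'w set" where
  "ev \<equiv> fst"

datatype 'w arc = Choice nat | Event "'w set"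

fun child :: "'w arc \<Rightarrow> ('w, 'r) dtree \<Rightarrow> ('w, 'r) dtree option" where
  "child (Choice i) (A, Decision m) = map_option (\<lambda>t. (A, t)) (fmlookup m i)"
| "child (Event E) (A, Chance m) = map_option (\<lambda>t. (A \<inter> E, t)) (fmlookup m E)"
| "child _ _ = None"

type_synonym 'w node = "'w arc list"

fun descend :: "'w node \<Rightarrow> ('w, 'r) dtree \<Rightarrow> ('w, 'r) dtree option" where
  "descend [] T = Some T"
| "descend (a # N) T = Option.bind (child a T) (descend N)"

definition nodes :: "('w, 'r) dtree \<Rightarrow> 'w node set" where
  "nodes T = {N. descend N T \<noteq> None}"

definition st :: "'w node \<Rightarrow> ('w, 'r) dtree \<Rightarrow> ('w, 'r) dtree" where
  "st N T = the (descend N T)"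

definition decision_tree :: "('w, 'r) dtree \<Rightarrow> bool" where
  "decision_tree T \<longleftrightarrow> (\<forall>N\<in>nodes T.
     case snd (st N T) of
       Leaf r \<Rightarrow> True
     | Decision m \<Rightarrow> fmdom' m \<noteq> {}
     | Chance m \<Rightarrow> partition_on UNIV (fmdom' m))"

definition consistent_tree :: "('w, 'r) dtree \<Rightarrow> bool" where
  "consistent_tree T \<longleftrightarrow> decision_tree T \<and> (\<forall>N\<in>nodes T. ev (st N T) \<noteq> {})"

primrec tree_gamb :: "('w, 'r) tree \<Rightarrow> ('w, 'r) gamble set" where
  "tree_gamb (Leaf r) = {\<lambda>_. r}"
| "tree_gamb (Decision m) = \<Union> (fmran' (fmmap tree_gamb m))"
| "tree_gamb (Chance m) = oplus_sets (fmmap tree_gamb m)"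

definition gamb :: "('w, 'r) dtree \<Rightarrow> ('w, 'r) gamble set" where
  "gamb T = tree_gamb (snd T)"

inductive pruning :: "('w, 'r) tree \<Rightarrow> ('w, 'r) tree \<Rightarrow> bool" where
  Leaf: "pruning (Leaf r) (Leaf r)"
| Decision: "pruning (Decision m') (Decision m)"
    if "fmdom' m' \<noteq> {}" "fmdom' m' \<subseteq> fmdom' m"
      "\<And>i s t. fmlookup m' i = Some s \<Longrightarrow> fmlookup m i = Some t \<Longrightarrow> pruning s t"
| Chance: "pruning (Chance m') (Chance m)"
    if "fmdom' m' = fmdom' m"
      "\<And>E s t. fmlookup m' E = Some s \<Longrightarrow> fmlookup m E = Some t \<Longrightarrow> pruning s t"

definition extensive_form_solution :: "('w, 'r) dtree \<Rightarrow> ('w, 'r) dtree \<Rightarrow> bool" where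
  "extensive_form_solution S T \<longleftrightarrow> ev S = ev T \<and> pruning (snd S) (snd T)"

definition nfd :: "('w, 'r) dtree \<Rightarrow> ('w, 'r) dtree set" where
  "nfd T = {U. extensive_form_solution U T \<and>
     (\<forall>N\<in>nodes U. \<forall>m. snd (st N U) = Decision m \<longrightarrow> card (fmdom' m) = 1)}"

type_synonym ('w, 'r) ext_op = "('w, 'r) dtree \<Rightarrow> ('w, 'r) dtree"

text \<open>Only consistent trees are considered; the values of an operator elsewhere are irrelevant.\<close>

definition extensive_form_operator :: "('w, 'r) ext_op \<Rightarrow> bool" where
  "extensive_form_operator ext \<longleftrightarrow>
     (\<forall>T. consistent_tree T \<longrightarrow> extensive_form_solution (ext T) T)"

definition subtree_perfect :: "('w, 'r) ext_op \<Rightarrow> bool" where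
  "subtree_perfect ext \<longleftrightarrow>
     (\<forall>T. consistent_tree T \<longrightarrow> (\<forall>N\<in>nodes (ext T). st N (ext T) = ext (st N T)))"

definition consequentialist :: "('w, 'r) ext_op \<Rightarrow> bool" where
  "consequentialist ext \<longleftrightarrow>
     (\<forall>T\<^sub>1 T\<^sub>2. consistent_tree T\<^sub>1 \<longrightarrow> consistent_tree T\<^sub>2 \<longrightarrow>
        gamb T\<^sub>1 = gamb T\<^sub>2 \<longrightarrow> ev T\<^sub>1 = ev T\<^sub>2 \<longrightarrow> gamb (ext T\<^sub>1) = gamb (ext T\<^sub>2))"

definition strongly_consequentialist :: "('w, 'r) ext_op \<Rightarrow> bool" where
  "strongly_consequentialist ext \<longleftrightarrow> consequentialist ext \<and>
     (\<forall>T. consistent_tree T \<longrightarrow>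
        (\<forall>U\<in>nfd T. gamb U \<subseteq> gamb (ext T) \<longrightarrow> U \<in> nfd (ext T)))"

text \<open>For consequentialist operators the value does not depend on the tree that is picked; a tree
  to pick exists precisely for the \<open>A\<close>-consistent non-empty finite sets.\<close>

definition opt_ext :: "('w, 'r) ext_op \<Rightarrow> ('w, 'r) choice" where
  "opt_ext ext \<XX> A = gamb (ext (SOME T. consistent_tree T \<and> gamb T = \<XX> \<and> ev T = A))"

end

theory Submission
  imports Defs
begin

text \<open>Given \<open>opt\<close>, the operator keeps at a decision node exactly the arcs whose subtree contributes
  a gamble to \<open>opt (gamb T) (ev T)\<close>, and recurses; subtree perfectness is then immediate. That
  \<open>gamb (ext T) = opt (gamb T) (ev T)\<close> follows by induction: the intersection property handles
  decision nodes, and at a chance node the mixture and intersection properties allow the cells of an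
  optimal gamble to be exchanged one at a time. Conditioning is needed only for strong
  consequentialism, where a normal form decision determines its gamble on a cell only up to the
  values outside the event.

  Conversely, each property of \<open>opt\<close> is read off one tree: a chance node with two arcs yields
  mixture, and conditioning as well once the root event is all of \<open>\<Omega>\<close>; a decision between trees
  for \<open>\<YY>\<close> and \<open>\<XX>\<close> yields intersection.\<close>

section \<open>Nodes and consistency\<close>

text \<open>A path is empty or starts with an arc to a child, so a condition on all nodes unfolds
  one level at a time. This links the definitions by paths to structural induction.\<close>

lemma ball_nodes_st:
  "(\<forall>N\<in>nodes T. P (st N T)) \<longleftrightarrow>
     P T \<and> (\<forall>a S. child a T = Some S \<longrightarrow> (\<forall>N\<in>nodes S. P (st N S)))"
proof -
  have "(\<forall>N. descend N T \<noteq> None \<longrightarrow> P (the (descend N T))) \<longleftrightarrow>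
     P T \<and> (\<forall>a S. child a T = Some S \<longrightarrow> (\<forall>N. descend N S \<noteq> None \<longrightarrow> P (the (descend N S))))"
    (is "?L \<longleftrightarrow> ?R")
  proof
    assume L: ?L
    have "P (the (descend N S))" if "child a T = Some S" "descend N S \<noteq> None" for a S N
      using L[rule_format, of "a # N"] that by simp
    with L[rule_format, of "[]"] show ?R by simp
  next
    assume R: ?R
    have "P (the (descend N T))" if "descend N T \<noteq> None" for N
    proof (cases N)
      case Nil
      with R show ?thesis by simp
    next
      case (Cons a N')
      with that obtain S where "child a T = Some S" "descend N' S \<noteq> None"
        by (cases "child a T") auto
      with R Cons show ?thesis by (simp del: split_paired_All)
    qed
    then show ?L by blast
  qed
  then show ?thesis by (simp add: nodes_def st_def)
qed

lemma child_Leaf: "child a (A, Leaf r) = None"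
  by (cases a) auto

lemma all_child_Leaf: "(\<forall>a S. child a (A, Leaf r) = Some S \<longrightarrow> Q S) \<longleftrightarrow> True"
  by (simp add: child_Leaf)

lemma all_child_Decision:
  "(\<forall>a S. child a (A, Decision m) = Some S \<longrightarrow> Q S) \<longleftrightarrow>
     (\<forall>i t. fmlookup m i = Some t \<longrightarrow> Q (A, t))" (is "?L \<longleftrightarrow> ?R")
proof
  assume ?R
  show ?L
  proof (intro allI impI)
    fix a S assume "child a (A, Decision m) = Some S"
    with \<open>?R\<close> show "Q S" by (cases a) auto
  qed
next
  assume L: ?L
  show ?R using L[rule_format, of "Choice i" for i] by simp
qed

lemma all_child_Chance:
  "(\<forall>a S. child a (A, Chance m) = Some S \<longrightarrow> Q S) \<longleftrightarrow>
     (\<forall>E t. fmlookup m E = Some t \<longrightarrow> Q (A \<inter> E, t))" (is "?L \<longleftrightarrow> ?R")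
proof
  assume ?R
  show ?L
  proof (intro allI impI)
    fix a S assume "child a (A, Chance m) = Some S"
    with \<open>?R\<close> show "Q S" by (cases a) auto
  qed
next
  assume L: ?L
  show ?R using L[rule_format, of "Event E" for E] by simp
qed

lemmas all_child = all_child_Leaf all_child_Decision all_child_Chance

text \<open>Both node conditions are unfolded by one level. As a rewrite rule the equation would
  loop, hence the instances per constructor below.\<close>

lemma consistent_tree_iff:
  "consistent_tree T \<longleftrightarrow> ev T \<noteq> {} \<and>
     (case snd T of Leaf r \<Rightarrow> True | Decision m \<Rightarrow> fmdom' m \<noteq> {} | Chance m \<Rightarrow> partition_on UNIV (fmdom' m)) \<and>
     (\<forall>a S. child a T = Some S \<longrightarrow> consistent_tree S)"
  unfolding consistent_tree_def decision_tree_def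
  by (subst (1 2) ball_nodes_st) auto

lemma consistent_Leaf: "consistent_tree (A, Leaf r) \<longleftrightarrow> A \<noteq> {}"
  by (subst consistent_tree_iff) (simp add: child_Leaf)

lemma consistent_Decision:
  "consistent_tree (A, Decision m) \<longleftrightarrow>
     A \<noteq> {} \<and> fmdom' m \<noteq> {} \<and> (\<forall>i t. fmlookup m i = Some t \<longrightarrow> consistent_tree (A, t))"
  by (subst consistent_tree_iff) (simp add: all_child del: split_paired_All)

lemma consistent_Chance:
  "consistent_tree (A, Chance m) \<longleftrightarrow>
     A \<noteq> {} \<and> partition_on UNIV (fmdom' m) \<and>
     (\<forall>E t. fmlookup m E = Some t \<longrightarrow> consistent_tree (A \<inter> E, t))"
  by (subst consistent_tree_iff) (simp add: all_child del: split_paired_All)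

lemmas consistent_simps = consistent_Leaf consistent_Decision consistent_Chance

lemma consistent_ev: "consistent_tree T \<Longrightarrow> ev T \<noteq> {}"
  by (subst (asm) consistent_tree_iff) simp

lemma partition_cell:
  assumes "partition_on UNIV (fmdom' m)"
  obtains E t where "fmlookup m E = Some t" "w \<in> E"
proof -
  have "w \<in> \<Union>(fmdom' m)" using assms by (simp add: partition_on_def)
  then show ?thesis using that by (auto simp: fmlookup_dom'_iff)
qed

lemma partition_cell_unique:
  assumes "partition_on UNIV (fmdom' m)" "fmlookup m E = Some t" "fmlookup m F = Some s"
    "w \<in> E" "w \<in> F"
  shows "E = F"
  using assms by (meson disjointD disjoint_iff fmdom'I partition_onD2)

section \<open>Gambles of trees\<close>

lemma restrict_eq_iff: "restrict f A = restrict g A \<longleftrightarrow> (\<forall>x\<in>A. f x = g x)"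
  by (auto simp: restrict_def fun_eq_iff)

lemma tree_gamb_Decision:
  "X \<in> tree_gamb (Decision m) \<longleftrightarrow> (\<exists>i t. fmlookup m i = Some t \<and> X \<in> tree_gamb t)"
  by (force simp: fmlookup_ran'_iff)

text \<open>Since \<open>y\<close> is determined by \<open>x\<close>, the witness can be chosen as a
  function of \<open>x\<close> alone, as the selection in \<open>oplus_sets\<close>
  requires.\<close>

lemma fmap_choice:
  assumes "\<forall>x y. fmlookup m x = Some y \<longrightarrow> (\<exists>z. P x y z)"
  shows "\<exists>f. \<forall>x y. fmlookup m x = Some y \<longrightarrow> P x y (f x)"
proof (intro exI allI impI)
  fix x y assume "fmlookup m x = Some y"
  with assms someI_ex[of "P x y"] show "P x y (SOME z. P x (the (fmlookup m x)) z)" by simp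
qed

lemma fmlookup_subset_dom:
  "fmdom' m \<subseteq> fmdom' n \<Longrightarrow> fmlookup m x = Some y \<Longrightarrow> \<exists>z. fmlookup n x = Some z"
  by (metis fmlookup_dom'_iff subsetD)

text \<open>By choice, the selection \<open>h\<close> can be traded for an independent witness on
  each arc; later arguments at chance nodes work cell by cell with this form.\<close>

lemma tree_gamb_Chance:
  "X \<in> tree_gamb (Chance m) \<longleftrightarrow>
     (\<forall>E t. fmlookup m E = Some t \<longrightarrow> (\<exists>Y\<in>tree_gamb t. \<forall>w\<in>E. X w = Y w))" (is "?L \<longleftrightarrow> ?R")
proof
  assume ?L
  then obtain h where "\<And>E t. fmlookup m E = Some t \<Longrightarrow> h E \<in> tree_gamb t \<and> (\<forall>w\<in>E. X w = h E w)"
    by (auto simp: oplus_sets_def restrict_eq_iff)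
  then show ?R by blast
next
  assume ?R
  then have *: "\<forall>E t. fmlookup m E = Some t \<longrightarrow> (\<exists>Y. Y \<in> tree_gamb t \<and> (\<forall>w\<in>E. X w = Y w))"
    by blast
  obtain h where "\<And>E t. fmlookup m E = Some t \<Longrightarrow> h E \<in> tree_gamb t \<and> (\<forall>w\<in>E. X w = h E w)"
    using fmap_choice[OF *] by blast
  then show ?L
    unfolding tree_gamb.simps oplus_sets_def mem_Collect_eq restrict_eq_iff
    by (intro exI[of _ h]) auto
qed

text \<open>Gluing: at \<open>w\<close> the gamble takes the value of \<open>h F\<close>, where
  \<open>F\<close> is the unique cell containing \<open>w\<close>.\<close>

lemma ex_combined_gamble:
  assumes "partition_on UNIV (fmdom' m)"
  obtains X where "\<And>E t w. fmlookup m E = Some t \<Longrightarrow> w \<in> E \<Longrightarrow> X w = h E w"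
proof
  fix E t w assume E: "fmlookup m E = Some t" "w \<in> E"
  have "(THE F. F \<in> fmdom' m \<and> w \<in> F) = E"
  proof (rule the_equality)
    show "E \<in> fmdom' m \<and> w \<in> E" using E by (simp add: fmdom'I)
    fix F assume "F \<in> fmdom' m \<and> w \<in> F"
    then obtain s where "fmlookup m F = Some s" "w \<in> F" by (auto simp: fmlookup_dom'_iff)
    with E show "F = E" using partition_cell_unique[OF assms] by blast
  qed
  then show "h (THE F. F \<in> fmdom' m \<and> w \<in> F) w = h E w" by simp
qed

lemma tree_gamb_nonempty:
  "consistent_tree (A, t) \<Longrightarrow> tree_gamb t \<noteq> {}"
proof (induction t arbitrary: A)
  case (Decision m)
  then obtain i t where it: "fmlookup m i = Some t"
    unfolding consistent_Decision by (meson all_not_in_conv fmdom'E)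
  with Decision have "tree_gamb t \<noteq> {}" by (meson consistent_Decision fmran'I)
  with it show ?case using tree_gamb_Decision by blast
next
  case (Chance m)
  then have *: "\<forall>E t. fmlookup m E = Some t \<longrightarrow> (\<exists>Y. Y \<in> tree_gamb t)"
    by (metis consistent_Chance ex_in_conv fmran'I)
  obtain h where h: "\<And>E t. fmlookup m E = Some t \<Longrightarrow> h E \<in> tree_gamb t"
    using fmap_choice[OF *] by blast
  from Chance.prems have "partition_on UNIV (fmdom' m)" by (simp add: consistent_simps)
  then obtain X where "\<And>E t w. fmlookup m E = Some t \<Longrightarrow> w \<in> E \<Longrightarrow> X w = h E w"
    by (rule ex_combined_gamble[where h = h]) blast
  with h have "X \<in> tree_gamb (Chance m)" by (auto simp: tree_gamb_Chance simp del: tree_gamb.simps)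
  then show ?case by blast
qed simp

lemma tree_gamb_finite:
  fixes t :: "('w::finite, 'r) tree"
  shows "consistent_tree (A, t) \<Longrightarrow> finite (tree_gamb t)"
proof (induction t arbitrary: A)
  case (Decision m)
  then have "finite (tree_gamb t)" if "t \<in> fmran' m" for t
    using that by (metis consistent_Decision fmlookup_ran'_iff)
  moreover have "finite (fmran' m)" by (simp add: fmran'_alt_def)
  ultimately show ?case by simp
next
  case (Chance m)
  \<comment> \<open>\<open>V\<close> collects all rewards that occur in the subtrees. It is finite
    by induction and because gambles have finite range, and a finite \<Omega> admits only finitely
    many maps into it.\<close>
  define V where "V = (\<Union>t\<in>fmran' m. \<Union>Y\<in>tree_gamb t. range Y)"
  have "finite (tree_gamb t)" if "t \<in> fmran' m" for t
    using that Chance by (metis consistent_Chance fmlookup_ran'_iff)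
  moreover have "finite (fmran' m)" by (simp add: fmran'_alt_def)
  ultimately have "finite V" by (simp add: V_def)
  then have "finite {X :: 'w \<Rightarrow> 'r. \<forall>w. X w \<in> V}"
    using finite_PiE[of "UNIV :: 'w set" "\<lambda>_. V"] by (simp add: PiE_UNIV_domain Pi_def)
  moreover have "tree_gamb (Chance m) \<subseteq> {X. \<forall>w. X w \<in> V}"
  proof (intro subsetI CollectI allI)
    fix X w assume X: "X \<in> tree_gamb (Chance m)"
    from Chance.prems obtain E t where "fmlookup m E = Some t" "w \<in> E"
      by (metis consistent_Chance partition_cell)
    with X obtain Y where "Y \<in> tree_gamb t" "X w = Y w"
      unfolding tree_gamb_Chance by blast
    with \<open>fmlookup m E = Some t\<close> show "X w \<in> V" unfolding V_def by (auto intro!: fmran'I)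
  qed
  ultimately show ?case by (rule rev_finite_subset)
qed simp

lemma event_consistent_iff:
  "event_consistent A \<XX> \<longleftrightarrow> (\<forall>X\<in>\<XX>. \<forall>w. \<exists>w'\<in>A. X w' = X w)"
  unfolding event_consistent_def by blast

text \<open>A value taken on a cell \<open>E\<close> is, by induction, also taken on
  \<open>A \<inter> E\<close>, hence on \<open>A\<close>. This is one half of the equivalence
  between \<open>A\<close>-consistency and the existence of a tree; \<open>ex_tree_gamb\<close> is
  the other.\<close>

lemma tree_gamb_event_consistent:
  "consistent_tree (A, t) \<Longrightarrow> event_consistent A (tree_gamb t)"
proof (induction t arbitrary: A)
  case (Leaf r)
  then show ?case by (auto simp: event_consistent_iff consistent_simps)
next
  case (Decision m)
  then have "event_consistent A (tree_gamb t)" if "fmlookup m i = Some t" for i t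
    using that by (metis consistent_Decision fmran'I)
  then show ?case unfolding event_consistent_iff using tree_gamb_Decision by blast
next
  case (Chance m)
  show ?case unfolding event_consistent_iff
  proof (intro ballI allI)
    fix X w assume X: "X \<in> tree_gamb (Chance m)"
    from Chance.prems obtain E t where Et: "fmlookup m E = Some t" "w \<in> E"
      by (metis consistent_Chance partition_cell)
    with X obtain Y where "Y \<in> tree_gamb t" "\<forall>w\<in>E. X w = Y w"
      unfolding tree_gamb_Chance by blast
    moreover have "event_consistent (A \<inter> E) (tree_gamb t)"
      using Chance Et by (metis consistent_Chance fmran'I)
    ultimately show "\<exists>w'\<in>A. X w' = X w"
      using Et(2) unfolding event_consistent_iff by (metis IntE)
  qed
qed

lemma tree_gamb_pruning: "pruning s t \<Longrightarrow> tree_gamb s \<subseteq> tree_gamb t"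
proof (induction rule: pruning.induct)
  case (Decision m' m)
  show ?case
  proof
    fix X assume "X \<in> tree_gamb (Decision m')"
    then obtain i s where si: "fmlookup m' i = Some s" "X \<in> tree_gamb s"
      unfolding tree_gamb_Decision by blast
    moreover obtain t where "fmlookup m i = Some t"
      using fmlookup_subset_dom[OF Decision(2) si(1)] by blast
    ultimately show "X \<in> tree_gamb (Decision m)"
      unfolding tree_gamb_Decision using Decision by blast
  qed
next
  case (Chance m' m)
  show ?case
  proof
    fix X assume X: "X \<in> tree_gamb (Chance m')"
    have "\<exists>Y\<in>tree_gamb t. \<forall>w\<in>E. X w = Y w" if t: "fmlookup m E = Some t" for E t
    proof -
      obtain s where "fmlookup m' E = Some s"
        using fmlookup_subset_dom[of m m' E t] Chance(1) t by auto
      with X t Chance show ?thesis unfolding tree_gamb_Chance by blast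
    qed
    then show "X \<in> tree_gamb (Chance m)" unfolding tree_gamb_Chance by blast
  qed
qed simp

section \<open>Normal form decisions\<close>

text \<open>The condition on arcs in \<open>nfd\<close>, named so that it can be unfolded level by
  level.\<close>

definition deterministic :: "('w, 'r) dtree \<Rightarrow> bool" where
  "deterministic U \<longleftrightarrow> (\<forall>N\<in>nodes U. \<forall>m. snd (st N U) = Decision m \<longrightarrow> card (fmdom' m) = 1)"

lemma deterministic_iff:
  "deterministic U \<longleftrightarrow> (\<forall>m. snd U = Decision m \<longrightarrow> card (fmdom' m) = 1) \<and>
     (\<forall>a S. child a U = Some S \<longrightarrow> deterministic S)"
  unfolding deterministic_def by (subst ball_nodes_st) (rule refl)

lemma deterministic_Leaf: "deterministic (A, Leaf r)"
  by (subst deterministic_iff) (simp add: child_Leaf)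

lemma deterministic_Decision:
  "deterministic (A, Decision m) \<longleftrightarrow>
     card (fmdom' m) = 1 \<and> (\<forall>i t. fmlookup m i = Some t \<longrightarrow> deterministic (A, t))"
  by (subst deterministic_iff) (simp add: all_child del: split_paired_All)

lemma deterministic_Chance:
  "deterministic (A, Chance m) \<longleftrightarrow>
     (\<forall>E t. fmlookup m E = Some t \<longrightarrow> deterministic (A \<inter> E, t))"
  by (subst deterministic_iff) (simp add: all_child del: split_paired_All)

lemma nfd_iff: "U \<in> nfd T \<longleftrightarrow> ev U = ev T \<and> pruning (snd U) (snd T) \<and> deterministic U"
  by (simp add: nfd_def extensive_form_solution_def deterministic_def)

lemma nfd_gamb_subset: "U \<in> nfd T \<Longrightarrow> gamb U \<subseteq> gamb T"
  by (simp add: nfd_iff gamb_def tree_gamb_pruning)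

lemma nfd_Leaf: "U \<in> nfd (A, Leaf r) \<longleftrightarrow> U = (A, Leaf r)"
  using deterministic_Leaf[of A r]
  by (cases U) (auto simp: nfd_iff intro: pruning.intros elim: pruning.cases)

lemma nfd_Decision:
  "U \<in> nfd (A, Decision m) \<longleftrightarrow>
     (\<exists>i t s. fmlookup m i = Some t \<and> (A, s) \<in> nfd (A, t) \<and> U = (A, Decision (fmupd i s fmempty)))"
  (is "?L \<longleftrightarrow> ?R")
proof
  assume L: ?L
  then obtain m' where m': "U = (A, Decision m')" "fmdom' m' \<subseteq> fmdom' m"
      "\<And>i s t. fmlookup m' i = Some s \<Longrightarrow> fmlookup m i = Some t \<Longrightarrow> pruning s t"
    by (cases U) (auto simp: nfd_iff elim: pruning.cases)
  from L m' have det: "card (fmdom' m') = 1" "\<And>i s. fmlookup m' i = Some s \<Longrightarrow> deterministic (A, s)"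
    unfolding nfd_iff by (simp_all add: deterministic_Decision)
  then obtain i where i: "fmdom' m' = {i}" by (auto simp: card_1_singleton_iff)
  then obtain s where s: "fmlookup m' i = Some s" by (auto simp: fmlookup_dom'_iff set_eq_iff)
  have "m' = fmupd i s fmempty"
    by (rule fmap_ext) (use i s in \<open>auto simp: fmdom'_notD\<close>)
  moreover obtain t where "fmlookup m i = Some t" using fmlookup_subset_dom[OF m'(2) s] by blast
  moreover from this have "pruning s t" using m'(3) s by blast
  moreover have "deterministic (A, s)" using det(2) s by blast
  ultimately show ?R using m'(1) unfolding nfd_iff by (metis fst_conv snd_conv)
next
  assume ?R
  then show ?L
    unfolding nfd_iff
    by (auto simp: deterministic_Decision fmdom'I split: if_splits intro!: pruning.Decision)
qed

lemma nfd_Chance: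
  "U \<in> nfd (A, Chance m) \<longleftrightarrow>
     (\<exists>m'. U = (A, Chance m') \<and> fmdom' m' = fmdom' m \<and>
       (\<forall>E s t. fmlookup m' E = Some s \<longrightarrow> fmlookup m E = Some t \<longrightarrow> (A \<inter> E, s) \<in> nfd (A \<inter> E, t)))"
  (is "?L \<longleftrightarrow> ?R")
proof
  assume L: ?L
  then obtain m' where "U = (A, Chance m')" "fmdom' m' = fmdom' m"
      "\<And>i s t. fmlookup m' i = Some s \<Longrightarrow> fmlookup m i = Some t \<Longrightarrow> pruning s t"
    by (cases U) (auto simp: nfd_iff elim: pruning.cases)
  with L show ?R unfolding nfd_iff by (auto simp: deterministic_Chance)
next
  assume ?R
  then obtain m' where m': "U = (A, Chance m')" "fmdom' m' = fmdom' m"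
      "\<And>E s t. fmlookup m' E = Some s \<Longrightarrow> fmlookup m E = Some t \<Longrightarrow> (A \<inter> E, s) \<in> nfd (A \<inter> E, t)"
    by blast
  have "deterministic (A \<inter> E, s)" if s: "fmlookup m' E = Some s" for E s
  proof -
    obtain t where "fmlookup m E = Some t"
      using fmlookup_subset_dom[of m' m E s] m'(2) s by auto
    with m'(3) s show ?thesis unfolding nfd_iff by auto
  qed
  with m' show ?L
    unfolding nfd_iff by (auto simp: deterministic_Chance intro!: pruning.Chance)
qed

lemma tree_gamb_Decision_single: "tree_gamb (Decision (fmupd i s fmempty)) = tree_gamb s"
  unfolding set_eq_iff tree_gamb_Decision by simp

lemma tree_gamb_Chance_singletons:
  assumes "partition_on UNIV (fmdom' m)"
    and "\<And>E s. fmlookup m E = Some s \<Longrightarrow> \<exists>Y. tree_gamb s = {Y} \<and> (\<forall>w\<in>E. X w = Y w)"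
  shows "tree_gamb (Chance m) = {X}"
proof -
  have "Z \<in> tree_gamb (Chance m) \<longleftrightarrow> Z = X" for Z
  proof
    assume Z: "Z \<in> tree_gamb (Chance m)"
    show "Z = X"
    proof
      fix w
      obtain E s where E: "fmlookup m E = Some s" "w \<in> E" by (rule partition_cell[OF assms(1)])
      with Z assms(2) show "Z w = X w" unfolding tree_gamb_Chance by fastforce
    qed
  next
    assume "Z = X"
    with assms(2) show "Z \<in> tree_gamb (Chance m)" unfolding tree_gamb_Chance by blast
  qed
  then show ?thesis by blast
qed

text \<open>With one arc at every decision node no choice remains; at a chance node the single
  gambles of the cells are glued together.\<close>

lemma nfd_tree_gamb_singleton:
  "consistent_tree (A, t) \<Longrightarrow> (A, u) \<in> nfd (A, t) \<Longrightarrow> \<exists>X. tree_gamb u = {X}"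
proof (induction t arbitrary: A u)
  case (Leaf r)
  then show ?case by (simp add: nfd_Leaf)
next
  case (Decision m)
  then obtain i t s where "fmlookup m i = Some t" "(A, s) \<in> nfd (A, t)"
      "u = Decision (fmupd i s fmempty)"
    by (auto simp: nfd_Decision)
  with Decision show ?case
    by (metis consistent_Decision fmran'I tree_gamb_Decision_single)
next
  case (Chance m)
  then obtain m' where m': "u = Chance m'" "fmdom' m' = fmdom' m"
      "\<And>E s t. fmlookup m' E = Some s \<Longrightarrow> fmlookup m E = Some t \<Longrightarrow> (A \<inter> E, s) \<in> nfd (A \<inter> E, t)"
    by (auto simp: nfd_Chance)
  have *: "\<forall>E s. fmlookup m' E = Some s \<longrightarrow> (\<exists>Y. tree_gamb s = {Y})"
  proof (intro allI impI)
    fix E s assume s: "fmlookup m' E = Some s"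
    obtain t where "fmlookup m E = Some t"
      using fmlookup_subset_dom[of m' m E s] m'(2) s by auto
    with m'(3) s Chance.prems(1) Chance.IH show "\<exists>Y. tree_gamb s = {Y}" by (meson consistent_Chance fmran'I)
  qed
  obtain h where h: "\<And>E s. fmlookup m' E = Some s \<Longrightarrow> tree_gamb s = {h E}"
    using fmap_choice[OF *] by blast
  from Chance.prems m' have part: "partition_on UNIV (fmdom' m')" by (simp add: consistent_simps)
  then obtain X where "\<And>E t w. fmlookup m' E = Some t \<Longrightarrow> w \<in> E \<Longrightarrow> X w = h E w"
    by (rule ex_combined_gamble[where h = h]) blast
  with h have "tree_gamb (Chance m') = {X}" by (intro tree_gamb_Chance_singletons[OF part]) blast
  with m' show ?case by simp
qed

lemma ex_fmap:
  assumes "finite D"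
  obtains m where "\<And>x. fmlookup m x = (if x \<in> D then Some (f x) else None)" "fmdom' m = D"
proof
  let ?g = "\<lambda>x. if x \<in> D then Some (f x) else None"
  have "finite (dom ?g)" using assms by (rule rev_finite_subset) (auto split: if_splits)
  then show l: "fmlookup (Abs_fmap ?g) x = (if x \<in> D then Some (f x) else None)" for x
    by (simp add: Abs_fmap_inverse)
  then show "fmdom' (Abs_fmap ?g) = D" by (auto simp: fmlookup_dom'_iff split: if_splits)
qed

text \<open>At a decision node, follow an arc whose subtree offers \<open>X\<close>; at a chance
  node, treat each cell separately with a gamble that agrees with \<open>X\<close> there.\<close>

lemma ex_nfd:
  "consistent_tree (A, t) \<Longrightarrow> X \<in> tree_gamb t \<Longrightarrow> \<exists>u. (A, u) \<in> nfd (A, t) \<and> tree_gamb u = {X}"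
proof (induction t arbitrary: A X)
  case (Leaf r)
  then show ?case by (auto simp: nfd_Leaf)
next
  case (Decision m)
  from Decision.prems(2) obtain i t where it: "fmlookup m i = Some t" "X \<in> tree_gamb t"
    unfolding tree_gamb_Decision by blast
  moreover from it Decision obtain u where "(A, u) \<in> nfd (A, t)" "tree_gamb u = {X}"
    by (meson consistent_Decision fmran'I)
  ultimately show ?case
    by (intro exI[of _ "Decision (fmupd i u fmempty)"])
      (auto simp: nfd_Decision tree_gamb_Decision_single simp del: tree_gamb.simps)
next
  case (Chance m)
  have *: "\<forall>E t. fmlookup m E = Some t \<longrightarrow>
      (\<exists>u. (A \<inter> E, u) \<in> nfd (A \<inter> E, t) \<and> (\<exists>Y. tree_gamb u = {Y} \<and> (\<forall>w\<in>E. X w = Y w)))"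
    using Chance unfolding tree_gamb_Chance by (meson consistent_Chance fmran'I)
  obtain f where f: "\<And>E t. fmlookup m E = Some t \<Longrightarrow>
      (A \<inter> E, f E) \<in> nfd (A \<inter> E, t) \<and> (\<exists>Y. tree_gamb (f E) = {Y} \<and> (\<forall>w\<in>E. X w = Y w))"
    using fmap_choice[OF *] by blast
  obtain m' where m': "\<And>E. fmlookup m' E = (if E \<in> fmdom' m then Some (f E) else None)"
      "fmdom' m' = fmdom' m"
    using finite_fmdom' by (rule ex_fmap[where f = f]) blast
  have "(A, Chance m') \<in> nfd (A, Chance m)"
    using f m' by (auto simp: nfd_Chance split: if_splits)
  moreover have "tree_gamb (Chance m') = {X}"
    using Chance.prems f m'
    by (intro tree_gamb_Chance_singletons)
      (auto simp: consistent_simps fmlookup_dom'_iff split: if_splits)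
  ultimately show ?case by blast
qed

section \<open>Trees with prescribed gambles\<close>

text \<open>Distinct arc names keep both subtrees present even when they are equal.\<close>

definition fork :: "('w, 'r) tree \<Rightarrow> ('w, 'r) tree \<Rightarrow> ('w, 'r) tree" where
  "fork s t = Decision (fmupd 0 s (fmupd 1 t fmempty))"

definition split_on :: "'w set \<Rightarrow> ('w, 'r) tree \<Rightarrow> ('w, 'r) tree \<Rightarrow> ('w, 'r) tree" where
  "split_on A s t = Chance (fmupd A s (fmupd (- A) t fmempty))"

lemma tree_gamb_fork: "tree_gamb (fork s t) = tree_gamb s \<union> tree_gamb t"
  unfolding set_eq_iff fork_def tree_gamb_Decision by auto

lemma consistent_fork:
  "consistent_tree (A, fork s t) \<longleftrightarrow> consistent_tree (A, s) \<and> consistent_tree (A, t)"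
  using consistent_ev[of "(A, s)"] by (auto simp: fork_def consistent_simps)

lemma partition_on_Compl: "A \<noteq> {} \<Longrightarrow> - A \<noteq> {} \<Longrightarrow> partition_on UNIV {A, - A}"
  by (auto simp: partition_on_def disjoint_def)

text \<open>Consistency of the subtrees makes \<open>B \<inter> A\<close> and
  \<open>B \<inter> - A\<close> non-empty, so \<open>A\<close> and \<open>- A\<close> are genuine
  cells.\<close>

lemma consistent_split_on:
  assumes "consistent_tree (B \<inter> A, s)" "consistent_tree (B \<inter> - A, t)"
  shows "consistent_tree (B, split_on A s t)"
proof -
  from assms[THEN consistent_ev] have "B \<noteq> {}" "A \<noteq> {}" "- A \<noteq> {}" by auto
  with assms show ?thesis by (auto simp: split_on_def consistent_simps partition_on_Compl)
qed

lemma fmlookup_split: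
  fixes A :: "'w set"
  shows
  "fmlookup (fmupd A s (fmupd (- A) t fmempty)) A = Some s"
  "fmlookup (fmupd A s (fmupd (- A) t fmempty)) (- A) = Some t"
proof -
  \<comment> \<open>A type has an element, which lies in only one of the two sets; so the outer
    update does not shadow the entry at \<open>- A\<close>.\<close>
  have "A \<noteq> - A" by blast
  then show "fmlookup (fmupd A s (fmupd (- A) t fmempty)) (- A) = Some t" by simp
qed simp

lemma tree_gamb_split_on:
  "X \<in> tree_gamb (split_on A s t) \<longleftrightarrow>
     (\<exists>Y\<in>tree_gamb s. \<forall>w\<in>A. X w = Y w) \<and> (\<exists>Y\<in>tree_gamb t. \<forall>w\<in>- A. X w = Y w)"
  unfolding split_on_def tree_gamb_Chance by (auto split: if_splits)

text \<open>Turns the sets of the mixture property into gambles of a two-cell chance node.\<close>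

lemma tree_gamb_split_on_single:
  assumes "tree_gamb t = {Z}"
  shows "tree_gamb (split_on A s t) = (\<lambda>X. mix A X Z) ` tree_gamb s"
  unfolding set_eq_iff tree_gamb_split_on
  by (auto simp: assms mix_def image_iff fun_eq_iff)

text \<open>The tree is a chance node on the level sets of \<open>X\<close>, each leading to a leaf
  with the value taken there. It is consistent because, by \<open>A\<close>-consistency, every level
  set meets \<open>A\<close>.\<close>

lemma ex_tree_gamb_singleton:
  fixes X :: "('w::finite, 'r) gamble"
  assumes "A \<noteq> {}" "event_consistent A {X}"
  shows "\<exists>t. consistent_tree (A, t) \<and> tree_gamb t = {X}"
proof -
  define D where "D = range (\<lambda>w. X -` {X w})"
  have "finite D" by (simp add: D_def)
  then obtain m :: "('w set, ('w, 'r) tree) fmap"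
    where m: "\<And>E. fmlookup m E = (if E \<in> D then Some (Leaf (X (SOME w. w \<in> E))) else None)"
      "fmdom' m = D"
    by (rule ex_fmap[where f = "\<lambda>E. Leaf (X (SOME w. w \<in> E)) :: ('w, 'r) tree"]) blast
  \<comment> \<open>\<open>X\<close> is constant on a level set, so the arbitrary point chosen for
    the leaf yields the right reward.\<close>
  have some: "X (SOME w. w \<in> X -` {X v}) = X v" for v
    using someI[of "\<lambda>w. w \<in> X -` {X v}" v] by simp
  have part: "partition_on UNIV D"
    by (auto simp: partition_on_def disjoint_def D_def)
  have "A \<inter> X -` {X w} \<noteq> {}" for w
    using assms(2) unfolding event_consistent_iff by fastforce
  with m part \<open>A \<noteq> {}\<close> have "consistent_tree (A, Chance m)"
    by (auto simp: consistent_simps D_def split: if_splits)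
  moreover have "tree_gamb (Chance m) = {X}"
    using m part some by (intro tree_gamb_Chance_singletons) (auto simp: D_def split: if_splits)
  ultimately show ?thesis by blast
qed

text \<open>Trees for the single gambles are joined by nested decisions.\<close>

lemma ex_tree_gamb:
  fixes \<XX> :: "('w::finite, 'r) gamble set"
  assumes "finite \<XX>" "\<XX> \<noteq> {}" "A \<noteq> {}" "event_consistent A \<XX>"
  shows "\<exists>t. consistent_tree (A, t) \<and> tree_gamb t = \<XX>"
  using assms(1,2,4)
proof (induction rule: finite_ne_induct)
  case (singleton X)
  with \<open>A \<noteq> {}\<close> show ?case by (rule ex_tree_gamb_singleton)
next
  case (insert X \<XX>)
  then have "event_consistent A \<XX>" "event_consistent A {X}"
    by (auto simp: event_consistent_def)
  then show ?case
    using insert.IH ex_tree_gamb_singleton[OF \<open>A \<noteq> {}\<close>, of X]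
    by (metis consistent_fork insert_is_Un tree_gamb_fork)
qed

section \<open>From choice functions to operators\<close>

text \<open>The event comes last because the recursion through \<open>fmmap\<close> produces
  functions of the event, which are then applied to \<open>A\<close> or \<open>A \<inter> E\<close>.
  The filter inspects the original subtrees, so the arcs kept at a node do not depend on any pruning
  below it.\<close>

primrec prune :: "('w, 'r) choice \<Rightarrow> ('w, 'r) tree \<Rightarrow> 'w set \<Rightarrow> ('w, 'r) tree" where
  "prune opt (Leaf r) = (\<lambda>A. Leaf r)"
| "prune opt (Decision m) = (\<lambda>A. Decision (fmmap (\<lambda>p. p A) (fmfilter
     (\<lambda>i. tree_gamb (the (fmlookup m i)) \<inter> opt (tree_gamb (Decision m)) A \<noteq> {})
     (fmmap (prune opt) m))))"
| "prune opt (Chance m) = (\<lambda>A. Chance (fmmap_keys (\<lambda>E p. p (A \<inter> E)) (fmmap (prune opt) m)))"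

lemma prune_Decision:
  obtains m' where "prune opt (Decision m) A = Decision m'"
    "\<And>i s. fmlookup m' i = Some s \<longleftrightarrow> (\<exists>t. fmlookup m i = Some t \<and>
       tree_gamb t \<inter> opt (tree_gamb (Decision m)) A \<noteq> {} \<and> s = prune opt t A)"
proof
  show "prune opt (Decision m) A = Decision (fmmap (\<lambda>p. p A) (fmfilter
     (\<lambda>i. tree_gamb (the (fmlookup m i)) \<inter> opt (tree_gamb (Decision m)) A \<noteq> {})
     (fmmap (prune opt) m)))" by simp
qed (auto simp del: tree_gamb.simps)

lemma prune_Chance:
  obtains m' where "prune opt (Chance m) A = Chance m'"
    "\<And>E. fmlookup m' E = map_option (\<lambda>t. prune opt t (A \<inter> E)) (fmlookup m E)" "fmdom' m' = fmdom' m"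
proof
  show "prune opt (Chance m) A = Chance (fmmap_keys (\<lambda>E p. p (A \<inter> E)) (fmmap (prune opt) m))" by simp
qed (auto simp: option.map_comp comp_def fmlookup_dom'_iff)

definition ext_of :: "('w, 'r) choice \<Rightarrow> ('w, 'r) ext_op" where
  "ext_of opt T = (ev T, prune opt (snd T) (ev T))"

text \<open>What remains below an arc depends only on the subtree there and its event, so pruning
  commutes with passing to a child. Iterated along a path, this is subtree perfectness.\<close>

lemma child_ext_of:
  "child a (ext_of opt T) = Some S \<Longrightarrow> \<exists>S'. child a T = Some S' \<and> S = ext_of opt S'"
proof -
  assume S: "child a (ext_of opt T) = Some S"
  obtain A t where T: "T = (A, t)" by (cases T)
  show ?thesis
  proof (cases t)
    case (Leaf r)
    with S T show ?thesis by (simp add: ext_of_def child_Leaf)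
  next
    case (Decision m)
    obtain m' where m': "prune opt (Decision m) A = Decision m'"
      "\<And>i s. fmlookup m' i = Some s \<longleftrightarrow> (\<exists>t. fmlookup m i = Some t \<and>
       tree_gamb t \<inter> opt (tree_gamb (Decision m)) A \<noteq> {} \<and> s = prune opt t A)"
      by (rule prune_Decision[of opt m A]) blast
    from S T Decision m' show ?thesis
      by (cases a) (auto simp: ext_of_def simp del: prune.simps)
  next
    case (Chance m)
    obtain m' where m': "prune opt (Chance m) A = Chance m'"
      "\<And>E. fmlookup m' E = map_option (\<lambda>t. prune opt t (A \<inter> E)) (fmlookup m E)"
      by (rule prune_Chance[of opt m A]) blast
    from S T Chance m' show ?thesis
      by (cases a) (auto simp: ext_of_def simp del: prune.simps)
  qed
qed

lemma descend_ext_of: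
  "descend N (ext_of opt T) = Some S \<Longrightarrow> \<exists>S'. descend N T = Some S' \<and> S = ext_of opt S'"
proof (induction N arbitrary: T)
  case (Cons a N)
  then obtain R where "child a (ext_of opt T) = Some R" "descend N R = Some S"
    by (cases "child a (ext_of opt T)") auto
  with Cons.IH child_ext_of[of a opt T R] show ?case by force
qed simp

lemma subtree_perfect_ext_of: "subtree_perfect (ext_of opt)"
  unfolding subtree_perfect_def
proof (intro allI impI ballI)
  fix T :: "('a, 'b) dtree" and N assume "N \<in> nodes (ext_of opt T)"
  then obtain S where S: "descend N (ext_of opt T) = Some S" unfolding nodes_def by auto
  then obtain S' where "descend N T = Some S'" "S = ext_of opt S'" using descend_ext_of by blast
  with S show "st N (ext_of opt T) = ext_of opt (st N T)" by (simp add: st_def)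
qed

section \<open>Optimal gambles at a chance node\<close>

lemma mix_self: "(\<And>w. w \<in> A \<Longrightarrow> Z w = X w) \<Longrightarrow> mix A X Z = Z"
  by (auto simp: mix_def)

text \<open>A gamble of a chance node is one of its own variations on a cell. This is how an optimal
  gamble is found in the subset to which the intersection property is applied.\<close>

lemma tree_gamb_Chance_cell:
  assumes "X \<in> tree_gamb (Chance m)" "fmlookup m E = Some t"
  shows "X \<in> (\<lambda>Y. mix E Y X) ` tree_gamb t"
proof -
  obtain Y where "Y \<in> tree_gamb t" "\<forall>w\<in>E. X w = Y w"
    using assms unfolding tree_gamb_Chance by blast
  with mix_self[of E X Y] show ?thesis by (metis image_eqI)
qed

context
  fixes opt :: "('w::finite, 'r) choice"
  assumes choice: "choice_function opt"
    and intersection: "intersection_property opt"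
    and mixture: "mixture_property opt"
begin

lemma opt_tree_gamb:
  "consistent_tree (A, t) \<Longrightarrow> opt (tree_gamb t) A \<noteq> {} \<and> opt (tree_gamb t) A \<subseteq> tree_gamb t"
  using choice tree_gamb_finite[of A t] tree_gamb_nonempty[of A t] consistent_ev[of "(A, t)"]
  unfolding choice_function_def by simp

text \<open>The gambles of a consistent tree meet the side conditions of the intersection property,
  and subsets inherit finiteness and \<open>A\<close>-consistency.\<close>

lemma opt_subset:
  assumes "consistent_tree (A, t)" "\<YY> \<subseteq> tree_gamb t" "opt (tree_gamb t) A \<inter> \<YY> \<noteq> {}"
  shows "opt \<YY> A = opt (tree_gamb t) A \<inter> \<YY>"
proof -
  have "finite (tree_gamb t)" "tree_gamb t \<noteq> {}" "A \<noteq> {}" "event_consistent A (tree_gamb t)"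
    using assms(1) tree_gamb_finite tree_gamb_nonempty tree_gamb_event_consistent consistent_ev
    by force+
  moreover have "finite \<YY>" "\<YY> \<noteq> {}" using assms(2,3) calculation(1) finite_subset by blast+
  moreover have "event_consistent A \<YY>"
    using assms(2) calculation(4) unfolding event_consistent_def by blast
  ultimately show ?thesis
    using intersection assms(2,3) unfolding intersection_property_def by blast
qed

text \<open>Let an optimal \<open>V\<close> vary on the cell \<open>E\<close> only. The intersection
  property says which variations are optimal among themselves, the mixture property computes the
  same set from the subtree at \<open>E\<close>; comparing the two gives the claim.\<close>

lemma opt_cell:
  assumes cons: "consistent_tree (A, Chance m)" and t: "fmlookup m E = Some t"
    and V: "V \<in> opt (tree_gamb (Chance m)) A"
  shows "opt (tree_gamb (Chance m)) A \<inter> (\<lambda>X. mix E X V) ` tree_gamb t =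
     (\<lambda>X. mix E X V) ` opt (tree_gamb t) (A \<inter> E)"
proof -
  let ?\<YY> = "(\<lambda>X. mix E X V) ` tree_gamb t"
  have V': "V \<in> tree_gamb (Chance m)" using V opt_tree_gamb[OF cons] by blast
  have part: "partition_on UNIV (fmdom' m)" and cons': "consistent_tree (A \<inter> E, t)"
    using cons t by (auto simp: consistent_simps)
  show ?thesis
  \<comment> \<open>If \<open>A\<close> lies inside \<open>E\<close>, the mixture property does not
    apply. But then every cell, as it meets \<open>A\<close>, is \<open>E\<close> itself, and the
    chance node has a single arc.\<close>
  proof (cases "- E \<inter> A = {}")
    case True
    have "w \<in> E" for w
    proof -
      obtain F s where F: "fmlookup m F = Some s" "w \<in> F" by (rule partition_cell[OF part])
      with cons have "A \<inter> F \<noteq> {}" using consistent_ev by (fastforce simp: consistent_Chance)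
      then obtain v where "v \<in> F" "v \<in> E" using True by blast
      with F t show ?thesis using partition_cell_unique[OF part] by blast
    qed
    then have E: "E = UNIV" by blast
    have "F = UNIV" if "fmlookup m F = Some s" for F s
    proof -
      have "F \<noteq> {}" using that partition_onD3[OF part] fmdom'I by metis
      with that t E show ?thesis using partition_cell_unique[OF part] by blast
    qed
    with t E have "F = UNIV \<and> s = t" if "fmlookup m F = Some s" for F s
      using that by fastforce
    with t E have "X \<in> tree_gamb (Chance m) \<longleftrightarrow> (\<exists>Y\<in>tree_gamb t. \<forall>w. X w = Y w)" for X
      unfolding tree_gamb_Chance by blast
    then have "tree_gamb (Chance m) = tree_gamb t"
      unfolding set_eq_iff fun_eq_iff[symmetric] by simp
    moreover have "mix E X V = X" for X by (simp add: mix_def E)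
    ultimately show ?thesis using opt_tree_gamb[OF cons] E by auto
  next
    case False
    then obtain w\<^sub>0 where w0: "w\<^sub>0 \<in> A" "w\<^sub>0 \<notin> E" by blast
    \<comment> \<open>The values of \<open>V\<close> on \<open>E\<close> may fail to occur on
      \<open>- E \<inter> A\<close>, so \<open>V\<close> itself need not be consistent with that
      event. They are overwritten by a value that does occur there, which no mixture on
      \<open>E\<close> can see.\<close>
    define Z where "Z = mix E (\<lambda>_. V w\<^sub>0) V"
    have mixZ: "mix E X Z = mix E X V" for X by (auto simp: mix_def Z_def)
    have "\<exists>w'\<in>- E \<inter> A. Z w' = Z w" for w
    proof (cases "w \<in> E")
      case True
      with w0 show ?thesis by (intro bexI[of _ w\<^sub>0]) (auto simp: Z_def mix_def)
    next
      case False
      \<comment> \<open>The cell \<open>F\<close> of \<open>w\<close> is disjoint from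
        \<open>E\<close>, and by consistency of the subtree at \<open>F\<close> the value at
        \<open>w\<close> recurs in \<open>A \<inter> F\<close>.\<close>
      obtain F s where F: "fmlookup m F = Some s" "w \<in> F" by (rule partition_cell[OF part])
      then have disj: "F \<inter> E = {}" using t False partition_cell_unique[OF part] by blast
      from F V' obtain Y where Y: "Y \<in> tree_gamb s" "\<forall>w\<in>F. V w = Y w"
        unfolding tree_gamb_Chance by blast
      have "event_consistent (A \<inter> F) (tree_gamb s)"
        using cons F(1) by (simp add: consistent_Chance tree_gamb_event_consistent)
      with Y obtain w' where "w' \<in> A \<inter> F" "Y w' = Y w"
        unfolding event_consistent_iff by blast
      with Y F disj False show ?thesis
        by (intro bexI[of _ w']) (auto simp: Z_def mix_def)
    qed
    then have "event_consistent (- E \<inter> A) {Z}" by (simp add: event_consistent_iff)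
    moreover have "E \<inter> A \<noteq> {}" using consistent_ev[OF cons'] by auto
    ultimately have "opt ((\<lambda>X. mix E X Z) ` tree_gamb t) A = (\<lambda>X. mix E X Z) ` opt (tree_gamb t) (E \<inter> A)"
      using mixture False cons' tree_gamb_nonempty tree_gamb_finite tree_gamb_event_consistent
      unfolding mixture_property_def by (metis Int_commute)
    then have *: "opt ?\<YY> A = (\<lambda>X. mix E X V) ` opt (tree_gamb t) (A \<inter> E)"
      by (simp add: mixZ Int_commute)
    have "?\<YY> \<subseteq> tree_gamb (Chance m)"
    proof
      fix X assume "X \<in> ?\<YY>"
      then obtain Y where Y: "Y \<in> tree_gamb t" "X = mix E Y V" by blast
      have "\<exists>Y'\<in>tree_gamb s. \<forall>w\<in>F. X w = Y' w" if F: "fmlookup m F = Some s" for F s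
      proof (cases "F = E")
        case True
        with Y F t show ?thesis by (auto simp: mix_def)
      next
        case False
        then have "X w = V w" if "w \<in> F" for w
        proof -
          have "w \<notin> E" using that F t False partition_cell_unique[OF part] by blast
          with Y show ?thesis by (simp add: mix_def)
        qed
        with V' F show ?thesis unfolding tree_gamb_Chance by metis
      qed
      then show "X \<in> tree_gamb (Chance m)" unfolding tree_gamb_Chance by blast
    qed
    \<comment> \<open>\<open>V\<close> witnesses that some variation is optimal, as the intersection
      property demands.\<close>
    moreover have "V \<in> ?\<YY>"
      using V' t by (rule tree_gamb_Chance_cell)
    ultimately have "opt ?\<YY> A = opt (tree_gamb (Chance m)) A \<inter> ?\<YY>"
      using V by (intro opt_subset[OF cons]) blast+
    with * show ?thesis by simp
  qed
qed

text \<open>From left to right, \<open>opt_cell\<close> is applied with \<open>X\<close> itself as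
  the optimal gamble. Conversely, any optimal gamble is turned into \<open>X\<close> by exchanging
  one cell after another, each exchange preserving optimality.\<close>

lemma opt_Chance:
  assumes cons: "consistent_tree (A, Chance m)"
  shows "X \<in> opt (tree_gamb (Chance m)) A \<longleftrightarrow>
     (\<forall>E t. fmlookup m E = Some t \<longrightarrow> (\<exists>Y\<in>opt (tree_gamb t) (A \<inter> E). \<forall>w\<in>E. X w = Y w))"
    (is "?L \<longleftrightarrow> ?R")
proof
  assume X: ?L
  then have X': "X \<in> tree_gamb (Chance m)" using opt_tree_gamb[OF cons] by blast
  show ?R
  proof (intro allI impI)
    fix E t assume t: "fmlookup m E = Some t"
    with X' have "X \<in> (\<lambda>Y. mix E Y X) ` tree_gamb t" by (rule tree_gamb_Chance_cell)
    with X have "X \<in> (\<lambda>Y. mix E Y X) ` opt (tree_gamb t) (A \<inter> E)"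
      using opt_cell[OF cons t X] by blast
    then obtain Y where "Y \<in> opt (tree_gamb t) (A \<inter> E)" "X = mix E Y X" by blast
    then show "\<exists>Y\<in>opt (tree_gamb t) (A \<inter> E). \<forall>w\<in>E. X w = Y w"
      by (metis mix_def)
  qed
next
  assume X: ?R
  have part: "partition_on UNIV (fmdom' m)" using cons by (simp add: consistent_simps)
  obtain V where V: "V \<in> opt (tree_gamb (Chance m)) A" using opt_tree_gamb[OF cons] by blast
  \<comment> \<open>\<open>C\<close> is the set of cells already exchanged: none at first, where the
    gamble is \<open>V\<close>, and all at the end, where it is \<open>X\<close>.\<close>
  have "finite C \<Longrightarrow> C \<subseteq> fmdom' m \<Longrightarrow> mix (\<Union>C) X V \<in> opt (tree_gamb (Chance m)) A" for C
  proof (induction C rule: finite_induct)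
    case empty
    with V show ?case by (simp add: mix_def)
  next
    case (insert E C)
    then obtain t where t: "fmlookup m E = Some t" by (auto simp: fmlookup_dom'_iff)
    with X obtain Y where Y: "Y \<in> opt (tree_gamb t) (A \<inter> E)" "\<forall>w\<in>E. X w = Y w" by blast
    let ?W = "mix (\<Union>C) X V"
    have "mix E Y ?W \<in> opt (tree_gamb (Chance m)) A"
      using opt_cell[OF cons t, of ?W] insert Y(1) by blast
    moreover have "mix E Y ?W = mix (\<Union>(insert E C)) X V"
      using Y(2) by (auto simp: mix_def)
    ultimately show ?case by simp
  qed
  from this[of "fmdom' m"] partition_onD1[OF part] show ?L by (simp add: mix_def)
qed

text \<open>At a decision node, a kept arc contributes by induction and the intersection property
  exactly the optimal gambles it offers. At a chance node, both sides have the same cellwise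
  description.\<close>

lemma tree_gamb_prune:
  "consistent_tree (A, t) \<Longrightarrow> tree_gamb (prune opt t A) = opt (tree_gamb t) A"
proof (induction t arbitrary: A)
  case (Leaf r)
  then show ?case using opt_tree_gamb[of A "Leaf r"] by auto
next
  case (Decision m)
  let ?O = "opt (tree_gamb (Decision m)) A"
  obtain m' where m': "prune opt (Decision m) A = Decision m'"
      "\<And>i s. fmlookup m' i = Some s \<longleftrightarrow> (\<exists>t. fmlookup m i = Some t \<and>
       tree_gamb t \<inter> ?O \<noteq> {} \<and> s = prune opt t A)"
    by (rule prune_Decision[of opt m A]) blast
  have *: "tree_gamb (prune opt t A) = ?O \<inter> tree_gamb t"
    if t: "fmlookup m i = Some t" "tree_gamb t \<inter> ?O \<noteq> {}" for i t
  proof -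
    have "tree_gamb t \<subseteq> tree_gamb (Decision m)" using t(1) tree_gamb_Decision by blast
    then have "opt (tree_gamb t) A = ?O \<inter> tree_gamb t"
      using opt_subset[OF Decision.prems] t(2) by blast
    with Decision t(1) show ?thesis by (metis consistent_Decision fmran'I)
  qed
  have "X \<in> tree_gamb (Decision m') \<longleftrightarrow> (\<exists>i t. fmlookup m i = Some t \<and>
      tree_gamb t \<inter> ?O \<noteq> {} \<and> X \<in> tree_gamb (prune opt t A))" for X
    unfolding tree_gamb_Decision[of X m'] m'(2) by blast
  then have "X \<in> tree_gamb (Decision m') \<longleftrightarrow> (\<exists>i t. fmlookup m i = Some t \<and> X \<in> ?O \<inter> tree_gamb t)" for X
    using * by blast
  moreover have "?O \<subseteq> tree_gamb (Decision m)" using opt_tree_gamb[OF Decision.prems] by blast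
  ultimately have "tree_gamb (Decision m') = ?O" using tree_gamb_Decision by blast
  with m' show ?case by simp
next
  case (Chance m)
  obtain m' where m': "prune opt (Chance m) A = Chance m'"
      "\<And>E. fmlookup m' E = map_option (\<lambda>t. prune opt t (A \<inter> E)) (fmlookup m E)"
    by (rule prune_Chance[of opt m A]) blast
  have *: "tree_gamb (prune opt t (A \<inter> E)) = opt (tree_gamb t) (A \<inter> E)" if "fmlookup m E = Some t" for E t
    using that Chance by (metis consistent_Chance fmran'I)
  have "X \<in> tree_gamb (Chance m') \<longleftrightarrow> (\<forall>E t. fmlookup m E = Some t \<longrightarrow>
      (\<exists>Y\<in>tree_gamb (prune opt t (A \<inter> E)). \<forall>w\<in>E. X w = Y w))" for X
    unfolding tree_gamb_Chance m'(2) by auto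
  with * have "tree_gamb (Chance m') = opt (tree_gamb (Chance m)) A"
    unfolding set_eq_iff[of "tree_gamb (Chance m')"] opt_Chance[OF Chance.prems] by simp
  with m' show ?case by simp
qed

section \<open>The pruning operator is an admissible operator\<close>

lemma gamb_ext_of: "consistent_tree T \<Longrightarrow> gamb (ext_of opt T) = opt (gamb T) (ev T)"
  by (simp add: gamb_def ext_of_def tree_gamb_prune)

lemma consequentialist_ext_of: "consequentialist (ext_of opt)"
  by (simp add: consequentialist_def gamb_ext_of del: split_paired_All)

lemma pruning_prune: "consistent_tree (A, t) \<Longrightarrow> pruning (prune opt t A) t"
proof (induction t arbitrary: A)
  case (Leaf r)
  then show ?case by (auto intro: pruning.Leaf)
next
  case (Decision m)
  let ?O = "opt (tree_gamb (Decision m)) A"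
  obtain m' where m': "prune opt (Decision m) A = Decision m'"
      "\<And>i s. fmlookup m' i = Some s \<longleftrightarrow> (\<exists>t. fmlookup m i = Some t \<and>
       tree_gamb t \<inter> ?O \<noteq> {} \<and> s = prune opt t A)"
    by (rule prune_Decision[of opt m A]) blast
  \<comment> \<open>An arc offering an optimal gamble survives, so the set of kept arcs is
    non-empty.\<close>
  obtain X where "X \<in> ?O" "X \<in> tree_gamb (Decision m)" using opt_tree_gamb[OF Decision.prems] by blast
  then have "\<exists>i s. fmlookup m' i = Some s" unfolding m'(2) tree_gamb_Decision by blast
  then have "fmdom' m' \<noteq> {}" by (auto dest: fmdom'I)
  moreover have "fmdom' m' \<subseteq> fmdom' m" using m'(2) by (auto simp: fmlookup_dom'_iff)
  moreover have "pruning (prune opt t A) t" if "fmlookup m i = Some t" for i t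
    using that Decision by (meson consistent_Decision fmran'I)
  ultimately show ?case unfolding m'(1) by (intro pruning.Decision) (auto simp: m'(2))
next
  case (Chance m)
  obtain m' where m': "prune opt (Chance m) A = Chance m'"
      "\<And>E. fmlookup m' E = map_option (\<lambda>t. prune opt t (A \<inter> E)) (fmlookup m E)" "fmdom' m' = fmdom' m"
    by (rule prune_Chance[of opt m A]) blast
  have "pruning (prune opt t (A \<inter> E)) t" if "fmlookup m E = Some t" for E t
    using that Chance by (meson consistent_Chance fmran'I)
  with m' show ?case unfolding m'(1) by (intro pruning.Chance) (auto simp: m'(2))
qed

lemma extensive_form_operator_ext_of: "extensive_form_operator (ext_of opt)"
  by (simp add: extensive_form_operator_def extensive_form_solution_def ext_of_def pruning_prune)

text \<open>An optimal normal form decision only passes through kept arcs, since each arc it takes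
  offers its gamble. Optimality is handed down to the subtree by the intersection property at
  decision nodes, and by \<open>opt_Chance\<close> with conditioning at chance nodes.\<close>

lemma nfd_prune:
  assumes conditioning: "conditioning_property opt"
  shows "consistent_tree (A, t) \<Longrightarrow> (A, u) \<in> nfd (A, t) \<Longrightarrow> tree_gamb u \<subseteq> opt (tree_gamb t) A \<Longrightarrow>
    (A, u) \<in> nfd (A, prune opt t A)"
proof (induction t arbitrary: A u)
  case (Leaf r)
  then show ?case by simp
next
  case (Decision m)
  let ?O = "opt (tree_gamb (Decision m)) A"
  obtain m' where m': "prune opt (Decision m) A = Decision m'"
      "\<And>i s. fmlookup m' i = Some s \<longleftrightarrow> (\<exists>t. fmlookup m i = Some t \<and>
       tree_gamb t \<inter> ?O \<noteq> {} \<and> s = prune opt t A)"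
    by (rule prune_Decision[of opt m A]) blast
  from Decision.prems(2) obtain i t s where u: "fmlookup m i = Some t" "(A, s) \<in> nfd (A, t)"
      "u = Decision (fmupd i s fmempty)"
    by (auto simp: nfd_Decision)
  have cons: "consistent_tree (A, t)" using Decision.prems(1) u(1) by (simp add: consistent_Decision)
  have sub: "tree_gamb s \<subseteq> tree_gamb t" using nfd_gamb_subset[OF u(2)] by (simp add: gamb_def)
  have sO: "tree_gamb s \<subseteq> ?O"
    using Decision.prems(3) u(3) by (simp add: tree_gamb_Decision_single del: tree_gamb.simps)
  have "tree_gamb s \<noteq> {}" using nfd_tree_gamb_singleton[OF cons u(2)] by auto
  with sub sO have ne: "tree_gamb t \<inter> ?O \<noteq> {}" by blast
  have "tree_gamb t \<subseteq> tree_gamb (Decision m)" using u(1) tree_gamb_Decision by blast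
  then have "opt (tree_gamb t) A = ?O \<inter> tree_gamb t"
    using opt_subset[OF Decision.prems(1)] ne by blast
  with sub sO have "tree_gamb s \<subseteq> opt (tree_gamb t) A" by blast
  then have "(A, s) \<in> nfd (A, prune opt t A)"
    using Decision.IH[OF fmran'I[OF u(1)] cons u(2)] by blast
  moreover have "fmlookup m' i = Some (prune opt t A)" using m'(2) u(1) ne by blast
  ultimately show ?case unfolding m'(1) nfd_Decision using u(3) by blast
next
  case (Chance m)
  obtain m' where m': "prune opt (Chance m) A = Chance m'"
      "\<And>E. fmlookup m' E = map_option (\<lambda>t. prune opt t (A \<inter> E)) (fmlookup m E)" "fmdom' m' = fmdom' m"
    by (rule prune_Chance[of opt m A]) blast
  from Chance.prems(2) obtain n where n: "u = Chance n" "fmdom' n = fmdom' m"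
      "\<And>E s t. fmlookup n E = Some s \<Longrightarrow> fmlookup m E = Some t \<Longrightarrow> (A \<inter> E, s) \<in> nfd (A \<inter> E, t)"
    by (auto simp: nfd_Chance)
  obtain X where X: "tree_gamb u = {X}" using nfd_tree_gamb_singleton[OF Chance.prems(1,2)] by blast
  have "(A \<inter> E, s) \<in> nfd (A \<inter> E, prune opt t (A \<inter> E))"
    if s: "fmlookup n E = Some s" and t: "fmlookup m E = Some t" for E s t
  proof -
    have cons: "consistent_tree (A \<inter> E, t)" using Chance.prems(1) t by (simp add: consistent_Chance)
    have nfd: "(A \<inter> E, s) \<in> nfd (A \<inter> E, t)" using n(3) s t .
    obtain Y where Y: "tree_gamb s = {Y}" using nfd_tree_gamb_singleton[OF cons nfd] by blast
    have XY: "\<forall>w\<in>E. X w = Y w"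
      using X s Y unfolding n(1) by (metis insertI1 singletonD tree_gamb_Chance)
    have "X \<in> opt (tree_gamb (Chance m)) A" using Chance.prems(3) X by blast
    \<comment> \<open>\<open>Y'\<close> is optimal on the cell but may differ off \<open>E\<close>
      from \<open>Y\<close>, the gamble of the decision itself. Both agree with \<open>X\<close> on
      \<open>E\<close>, so conditioning carries optimality over to \<open>Y\<close>.\<close>
    then obtain Y' where Y': "Y' \<in> opt (tree_gamb t) (A \<inter> E)" "\<forall>w\<in>E. X w = Y' w"
      using t unfolding opt_Chance[OF Chance.prems(1)] by blast
    have "Y \<in> tree_gamb t" using nfd_gamb_subset[OF nfd] Y by (simp add: gamb_def)
    moreover have "Y' \<in> tree_gamb t" using Y'(1) opt_tree_gamb[OF cons] by blast
    moreover have "restrict Y' (A \<inter> E) = restrict Y (A \<inter> E)"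
      using XY Y'(2) by (simp add: restrict_eq_iff)
    ultimately have "Y \<in> opt (tree_gamb t) (A \<inter> E)"
      using conditioning Y'(1) tree_gamb_finite[OF cons] tree_gamb_nonempty[OF cons]
        tree_gamb_event_consistent[OF cons] consistent_ev[OF cons]
      unfolding conditioning_property_def by (metis fst_conv)
    with Chance.IH[OF fmran'I[OF t] cons nfd] Y show ?thesis by simp
  qed
  then show ?case unfolding m'(1) nfd_Chance using n(1,2) m'(2,3) by auto
qed

lemma strongly_consequentialist_ext_of:
  assumes "conditioning_property opt"
  shows "strongly_consequentialist (ext_of opt)"
  unfolding strongly_consequentialist_def
proof (intro conjI allI impI ballI)
  show "consequentialist (ext_of opt)" by (rule consequentialist_ext_of)
next
  fix T U assume T: "consistent_tree T" and U: "U \<in> nfd T" "gamb U \<subseteq> gamb (ext_of opt T)"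
  have "(ev T, snd U) \<in> nfd (ev T, prune opt (snd T) (ev T))"
    using nfd_prune[OF assms, of "ev T" "snd T" "snd U"] T U gamb_ext_of[OF T]
    by (metis gamb_def nfd_iff prod.collapse)
  then show "U \<in> nfd (ext_of opt T)" using U(1) unfolding ext_of_def by (metis nfd_iff prod.collapse)
qed

end

text \<open>Consistency of \<open>\<XX>\<close> with \<open>A\<close> supplies a tree, so the tree
  picked in \<open>opt_ext\<close> has the required gambles and event, on which alone the value
  depends.\<close>

lemma opt_ext_eq:
  fixes \<XX> :: "('w::finite, 'r) gamble set"
  assumes "\<And>T. consistent_tree T \<Longrightarrow> gamb (ext T) = opt (gamb T) (ev T)"
    and "A \<noteq> {}" "\<XX> \<noteq> {}" "finite \<XX>" "event_consistent A \<XX>"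
  shows "opt_ext ext \<XX> A = opt \<XX> A"
proof -
  obtain t where "consistent_tree (A, t)" "tree_gamb t = \<XX>" using ex_tree_gamb assms by blast
  then have T: "consistent_tree (A, t) \<and> gamb (A, t) = \<XX> \<and> ev (A, t) = A" by (simp add: gamb_def)
  define S where "S = (SOME T. consistent_tree T \<and> gamb T = \<XX> \<and> ev T = A)"
  have S: "consistent_tree S \<and> gamb S = \<XX> \<and> ev S = A" unfolding S_def using T by (rule someI)
  then have "gamb (ext S) = opt \<XX> A" using assms(1)[of S] by simp
  then show ?thesis by (simp add: opt_ext_def S_def)
qed

section \<open>From operators to choice functions\<close>

lemma fmupd_empty_inject: "fmupd i s fmempty = fmupd j t fmempty \<longleftrightarrow> i = j \<and> s = t"
  by (metis fmempty_lookup fmupd_lookup option.distinct(1) option.inject)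

lemma nfd_split_on:
  "(B, split_on A u v) \<in> nfd (B, split_on A s t) \<longleftrightarrow>
     (B \<inter> A, u) \<in> nfd (B \<inter> A, s) \<and> (B \<inter> - A, v) \<in> nfd (B \<inter> - A, t)" (is "?L \<longleftrightarrow> ?R")
proof
  assume ?L
  then show ?R
    unfolding split_on_def nfd_Chance using fmlookup_split by (metis Pair_inject tree.inject(3))
next
  assume ?R
  then show ?L
    unfolding split_on_def nfd_Chance
    by (intro exI[of _ "fmupd A u (fmupd (- A) v fmempty)"]) (auto split: if_splits)
qed

lemma ex_nfd_fork:
  assumes "(A, u) \<in> nfd (A, s)"
  shows "(A, Decision (fmupd 0 u fmempty)) \<in> nfd (A, fork s t)"
proof -
  have "fmlookup (fmupd 0 s (fmupd (1::nat) t fmempty)) 0 = Some s" by simp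
  with assms show ?thesis unfolding fork_def nfd_Decision by blast
qed

section \<open>Operators that induce a given choice function\<close>

context
  fixes ext :: "('w::finite, 'r) ext_op" and opt :: "('w, 'r) choice"
  assumes choice: "choice_function opt"
    and operator: "extensive_form_operator ext"
    and perfect: "subtree_perfect ext"
    and strong: "strongly_consequentialist ext"
    and opt_ext: "\<And>A \<XX>. A \<noteq> {} \<Longrightarrow> \<XX> \<noteq> {} \<Longrightarrow> finite \<XX> \<Longrightarrow> event_consistent A \<XX> \<Longrightarrow>
      opt_ext ext \<XX> A = opt \<XX> A"
begin

text \<open>\<open>T\<close> itself qualifies for the choice in \<open>opt_ext\<close>, and by
  consequentialism the tree actually picked gives the same gambles.\<close>

lemma gamb_ext:
  assumes T: "consistent_tree T"
  shows "gamb (ext T) = opt (gamb T) (ev T)"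
proof -
  obtain A t where At: "T = (A, t)" by (cases T)
  let ?P = "\<lambda>S. consistent_tree S \<and> gamb S = gamb T \<and> ev S = ev T"
  have "opt (gamb T) (ev T) = opt_ext ext (gamb T) (ev T)"
    using opt_ext[of "ev T" "gamb T"] T consistent_ev[OF T] tree_gamb_finite[of A t]
      tree_gamb_nonempty[of A t] tree_gamb_event_consistent[of A t] by (simp add: At gamb_def)
  also have "\<dots> = gamb (ext (Eps ?P))" by (simp add: opt_ext_def)
  also have "\<dots> = gamb (ext T)"
    using someI[of ?P T] T strong unfolding strongly_consequentialist_def consequentialist_def by blast
  finally show ?thesis ..
qed

text \<open>Subtree perfectness along a path with a single arc.\<close>

lemma child_ext:
  assumes "consistent_tree T" "child a T = Some S'" "child a (ext T) = Some S"
  shows "S = ext S'"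
proof -
  have "[a] \<in> nodes (ext T)" using assms(3) by (simp add: nodes_def)
  with perfect assms(1) have "st [a] (ext T) = ext (st [a] T)" unfolding subtree_perfect_def by blast
  with assms(2,3) show ?thesis by (simp add: st_def)
qed

lemma pruning_ext: "consistent_tree T \<Longrightarrow> ev (ext T) = ev T \<and> pruning (snd (ext T)) (snd T)"
  using operator unfolding extensive_form_operator_def extensive_form_solution_def by blast

lemma nfd_ext:
  "consistent_tree T \<Longrightarrow> U \<in> nfd T \<Longrightarrow> gamb U \<subseteq> gamb (ext T) \<Longrightarrow> U \<in> nfd (ext T)"
  using strong unfolding strongly_consequentialist_def by blast

text \<open>A solution keeps every arc of a chance node, and subtree perfectness fixes what hangs on
  each.\<close>

lemma ext_split_on:
  assumes "consistent_tree (B \<inter> A, s)" "consistent_tree (B \<inter> - A, t)"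
  shows "ext (B, split_on A s t) = (B, split_on A (snd (ext (B \<inter> A, s))) (snd (ext (B \<inter> - A, t))))"
proof -
  let ?T = "(B, split_on A s t)"
  have cons: "consistent_tree ?T" using assms by (rule consistent_split_on)
  from pruning_ext[OF cons] obtain m' where m': "ext ?T = (B, Chance m')" "fmdom' m' = {A, - A}"
    unfolding split_on_def by (cases "ext ?T") (auto simp: split_on_def elim: pruning.cases)
  have A: "fmlookup m' A = Some (snd (ext (B \<inter> A, s)))"
  proof -
    obtain s' where s': "fmlookup m' A = Some s'" using m'(2) by (metis fmlookup_dom'_iff insertI1)
    have "(B \<inter> A, s') = ext (B \<inter> A, s)"
      by (rule child_ext[OF cons, of "Event A"], simp add: split_on_def fmlookup_split)
        (simp add: m' s')
    with s' show ?thesis by (metis snd_conv)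
  qed
  have A': "fmlookup m' (- A) = Some (snd (ext (B \<inter> - A, t)))"
  proof -
    obtain t' where t': "fmlookup m' (- A) = Some t'"
      using m'(2) by (metis fmlookup_dom'_iff insertI1 insertI2)
    have "(B \<inter> - A, t') = ext (B \<inter> - A, t)"
      by (rule child_ext[OF cons, of "Event (- A)"], simp add: split_on_def fmlookup_split del: fmupd_lookup)
        (simp add: m' t')
    with t' show ?thesis by (metis snd_conv)
  qed
  have "m' = fmupd A (snd (ext (B \<inter> A, s))) (fmupd (- A) (snd (ext (B \<inter> - A, t))) fmempty)"
  proof (rule fmap_ext)
    fix E
    show "fmlookup m' E =
      fmlookup (fmupd A (snd (ext (B \<inter> A, s))) (fmupd (- A) (snd (ext (B \<inter> - A, t))) fmempty)) E"
      using A A' m'(2) by (cases "E \<in> {A, - A}") (auto simp: fmdom'_notD)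
  qed
  with m'(1) show ?thesis by (simp add: split_on_def)
qed

text \<open>A choice from a singleton is forced.\<close>

lemma tree_gamb_ext_single:
  assumes "consistent_tree (A, t)" "tree_gamb t = {Z}"
  shows "tree_gamb (snd (ext (A, t))) = {Z}"
  using gamb_ext[OF assms(1)] choice assms(2) consistent_ev[OF assms(1)]
  unfolding choice_function_def gamb_def by (metis finite.simps fst_conv insert_not_empty snd_conv subset_singletonD)

section \<open>The three properties of the choice function\<close>

text \<open>Attached to the arc \<open>A\<close> of a chance node, normal form decisions with gambles that agree on \<open>A\<close>
  yield the same gamble, so strong consequentialism keeps both or none.\<close>

lemma conditioning_ext: "conditioning_property opt"
  unfolding conditioning_property_def
proof (intro allI impI ballI)
  fix A \<XX> X Y
  assume *: "A \<noteq> {}" "\<XX> \<noteq> {}" "finite \<XX>" "event_consistent A \<XX>" and XY: "X \<in> \<XX>" "Y \<in> \<XX>"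
    "restrict X A = restrict Y A" and X: "X \<in> opt \<XX> A"
  show "Y \<in> opt \<XX> A"
  \<comment> \<open>There is no complementary arc if \<open>A\<close> is everything, but then
    \<open>X\<close> and \<open>Y\<close> coincide.\<close>
  proof (cases "A = UNIV")
    case True
    with XY(3) have "X = Y" by (simp add: restrict_eq_iff fun_eq_iff)
    with X show ?thesis by simp
  next
    case False
    obtain t where t: "consistent_tree (A, t)" "tree_gamb t = \<XX>" using ex_tree_gamb * by blast
    obtain u where u: "(A, u) \<in> nfd (A, t)" "tree_gamb u = {Y}" using ex_nfd[OF t(1), of Y] t(2) XY(2) by blast
    \<comment> \<open>The leaf on the arc \<open>- A\<close> only completes the partition;
      \<open>undefined\<close> stands for an arbitrary reward.\<close>
    define l :: "('w, 'r) tree" where "l = Leaf undefined"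
    define z :: "('w, 'r) gamble" where "z = (\<lambda>_. undefined)"
    have l: "consistent_tree (- A, l)" "tree_gamb l = {z}" "(- A, l) \<in> nfd (- A, l)"
      using False by (auto simp: l_def z_def consistent_Leaf nfd_Leaf)
    \<comment> \<open>With root event \<open>UNIV\<close>, the subtrees have the events
      \<open>A\<close> and \<open>- A\<close>.\<close>
    let ?T = "(UNIV, split_on A t l)" and ?U = "(UNIV, split_on A u l)"
    have cons: "consistent_tree ?T" using consistent_split_on[of UNIV A t l] t l by simp
    have extT: "ext ?T = (UNIV, split_on A (snd (ext (A, t))) (snd (ext (- A, l))))"
      using ext_split_on[of UNIV A t l] t l by simp
    have "gamb (ext ?T) = (\<lambda>X. mix A X z) ` opt \<XX> A"
      using gamb_ext[OF t(1)] t(2) tree_gamb_ext_single[OF l(1,2)]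
      unfolding extT gamb_def by (simp add: tree_gamb_split_on_single)
    moreover have "gamb ?U = {mix A Y z}"
      unfolding gamb_def using u(2) l(2) by (simp add: tree_gamb_split_on_single)
    moreover have "mix A Y z = mix A X z" using XY(3) by (auto simp: mix_def restrict_eq_iff)
    ultimately have "gamb ?U \<subseteq> gamb (ext ?T)" using X by auto
    moreover have "?U \<in> nfd ?T" using nfd_split_on[of UNIV A u l t l] u l by simp
    ultimately have "?U \<in> nfd (ext ?T)" by (intro nfd_ext[OF cons])
    \<comment> \<open>Reading the retained decision along the arc \<open>A\<close> shows that
      \<open>u\<close> survives in the solution of the subtree.\<close>
    then have "(A, u) \<in> nfd (A, snd (ext (A, t)))"
      unfolding extT using nfd_split_on[of UNIV A u l] by simp
    then have "Y \<in> gamb (ext (A, t))" using nfd_gamb_subset u(2) by (fastforce simp: gamb_def)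
    with gamb_ext[OF t(1)] t(2) show ?thesis by (simp add: gamb_def)
  qed
qed

text \<open>The decision between trees for \<open>\<YY>\<close> and \<open>\<XX>\<close> has the
  gambles \<open>\<XX>\<close>. An optimal gamble in \<open>\<YY>\<close> is realised through the
  first arc, which strong consequentialism retains and below which subtree perfectness finds the
  solution for \<open>\<YY>\<close>.\<close>

lemma intersection_ext: "intersection_property opt"
  unfolding intersection_property_def
proof (intro allI impI)
  fix A \<XX> \<YY>
  assume A: "A \<noteq> {}" and X: "\<XX> \<noteq> {}" "finite \<XX>" "event_consistent A \<XX>"
    and Y: "\<YY> \<noteq> {}" "finite \<YY>" "event_consistent A \<YY>"
    and sub: "\<YY> \<subseteq> \<XX>" and ne: "opt \<XX> A \<inter> \<YY> \<noteq> {}"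
  obtain t where t: "consistent_tree (A, t)" "tree_gamb t = \<XX>" using ex_tree_gamb A X by blast
  obtain s where s: "consistent_tree (A, s)" "tree_gamb s = \<YY>" using ex_tree_gamb A Y by blast
  let ?T = "(A, fork s t)"
  have cons: "consistent_tree ?T" using s t by (simp add: consistent_fork)
  have "tree_gamb (fork s t) = \<XX>" using s t sub by (auto simp: tree_gamb_fork)
  with gamb_ext[OF cons] have extT: "gamb (ext ?T) = opt \<XX> A" by (simp add: gamb_def)
  have exts: "gamb (ext (A, s)) = opt \<YY> A" using gamb_ext[OF s(1)] s(2) by (simp add: gamb_def)
  from pruning_ext[OF cons] obtain m' where m': "ext ?T = (A, Decision m')"
    by (cases "ext ?T") (auto simp: fork_def elim: pruning.cases)
  have key: "fmlookup m' 0 = Some (snd (ext (A, s))) \<and> y \<in> opt \<YY> A" if y: "y \<in> opt \<XX> A \<inter> \<YY>" for y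
  proof -
    obtain u where u: "(A, u) \<in> nfd (A, s)" "tree_gamb u = {y}" using ex_nfd[OF s(1), of y] s(2) y by blast
    let ?U = "(A, Decision (fmupd 0 u fmempty))"
    have "gamb ?U = {y}" using u(2) tree_gamb_Decision_single[of 0 u] by (simp add: gamb_def)
    with y extT have "gamb ?U \<subseteq> gamb (ext ?T)" by simp
    then have "?U \<in> nfd (ext ?T)" by (rule nfd_ext[OF cons ex_nfd_fork[OF u(1)]])
    then obtain s' where s': "fmlookup m' 0 = Some s'" "(A, u) \<in> nfd (A, s')"
      unfolding m' nfd_Decision by (auto simp: fmupd_empty_inject)
    have "(A, s') = ext (A, s)"
      by (rule child_ext[OF cons, of "Choice 0"], simp add: fork_def) (simp add: m' s')
    moreover from this have "y \<in> gamb (ext (A, s))"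
      using nfd_gamb_subset[OF s'(2)] u(2) by (simp add: gamb_def)
    ultimately show ?thesis using s'(1) exts by (metis snd_conv)
  qed
  \<comment> \<open>One common gamble suffices to keep arc 0, and then all of
    \<open>opt \<YY> A\<close> is optimal at the root.\<close>
  with ne have "fmlookup m' 0 = Some (snd (ext (A, s)))" by blast
  then have "gamb (ext (A, s)) \<subseteq> gamb (ext ?T)" unfolding gamb_def m' snd_conv using tree_gamb_Decision by blast
  moreover have "opt \<YY> A \<subseteq> \<YY>" using choice A Y unfolding choice_function_def by blast
  ultimately show "opt \<YY> A = opt \<XX> A \<inter> \<YY>" using key extT exts by blast
qed

text \<open>The gambles of the solution of one chance node are computed twice: from the gambles at
  the root, and from the solutions of its two subtrees.\<close>

lemma mixture_ext: "mixture_property opt"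
  unfolding mixture_property_def
proof (intro allI impI)
  fix A B and Z :: "('w, 'r) gamble" and \<XX> :: "('w, 'r) gamble set"
  assume A: "A \<inter> B \<noteq> {}" and A': "- A \<inter> B \<noteq> {}" and Z: "event_consistent (- A \<inter> B) {Z}"
    and X: "\<XX> \<noteq> {}" "finite \<XX>" "event_consistent (A \<inter> B) \<XX>"
  obtain t where t: "consistent_tree (B \<inter> A, t)" "tree_gamb t = \<XX>"
    using ex_tree_gamb[of \<XX> "A \<inter> B"] A X by (auto simp: Int_commute)
  obtain z where z: "consistent_tree (B \<inter> - A, z)" "tree_gamb z = {Z}"
    using ex_tree_gamb[of "{Z}" "- A \<inter> B"] A' Z by (auto simp: Int_commute)
  let ?T = "(B, split_on A t z)"
  have "gamb (ext ?T) = opt (gamb ?T) B"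
    using gamb_ext[OF consistent_split_on[OF t(1) z(1)]] by simp
  moreover have "gamb ?T = (\<lambda>X. mix A X Z) ` \<XX>"
    using t(2) z(2) by (simp add: gamb_def tree_gamb_split_on_single)
  moreover have "gamb (ext ?T) = (\<lambda>X. mix A X Z) ` opt \<XX> (B \<inter> A)"
    using gamb_ext[OF t(1)] t(2) tree_gamb_ext_single[OF z]
    unfolding ext_split_on[OF t(1) z(1)] by (simp add: gamb_def tree_gamb_split_on_single)
  ultimately show "opt ((\<lambda>X. mix A X Z) ` \<XX>) B = (\<lambda>X. mix A X Z) ` opt \<XX> (A \<inter> B)"
    by (simp add: Int_commute)
qed

end

theorem theorem37:
  fixes opt :: "('w::finite, 'r) choice"
  assumes "choice_function opt"
  shows "conditioning_property opt \<and> intersection_property opt \<and> mixture_property opt \<longleftrightarrow>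
    (\<exists>ext :: ('w, 'r) ext_op.
       extensive_form_operator ext \<and> subtree_perfect ext \<and> strongly_consequentialist ext \<and>
       (\<forall>A \<XX>. A \<noteq> {} \<longrightarrow> \<XX> \<noteq> {} \<longrightarrow> finite \<XX> \<longrightarrow> event_consistent A \<XX> \<longrightarrow>
          opt_ext ext \<XX> A = opt \<XX> A))"
proof (intro iffI; elim conjE exE)
  assume opt: "conditioning_property opt" "intersection_property opt" "mixture_property opt"
  note assms' = assms opt(2,3)
  show "\<exists>ext :: ('w, 'r) ext_op.
       extensive_form_operator ext \<and> subtree_perfect ext \<and> strongly_consequentialist ext \<and>
       (\<forall>A \<XX>. A \<noteq> {} \<longrightarrow> \<XX> \<noteq> {} \<longrightarrow> finite \<XX> \<longrightarrow> event_consistent A \<XX> \<longrightarrow>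
          opt_ext ext \<XX> A = opt \<XX> A)"
    using extensive_form_operator_ext_of[OF assms'] subtree_perfect_ext_of[of opt]
      strongly_consequentialist_ext_of[OF assms' opt(1)] opt_ext_eq[of "ext_of opt" opt, OF gamb_ext_of[OF assms']]
    by (intro exI[of _ "ext_of opt"]) blast
next
  fix ext :: "('w, 'r) ext_op"
  assume ext: "extensive_form_operator ext" "subtree_perfect ext" "strongly_consequentialist ext"
    "\<forall>A \<XX>. A \<noteq> {} \<longrightarrow> \<XX> \<noteq> {} \<longrightarrow> finite \<XX> \<longrightarrow> event_consistent A \<XX> \<longrightarrow>
       opt_ext ext \<XX> A = opt \<XX> A"
  note facts = assms ext(1-3) ext(4)[rule_format]
  show "conditioning_property opt \<and> intersection_property opt \<and> mixture_property opt"
    using conditioning_ext[OF facts] intersection_ext[OF facts] mixture_ext[OF facts] by blast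
qed

end
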